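(* Let $\mathcal G$ be an étale groupoid. Then $\mathcal G$ is strongly amenable at infinity if and only if the Stone–Čech fibrewise compactification $(\beta_r\mathcal G, r_\beta)$ of the fibre space $(\mathcal G, r)$, with its canonical $\mathcal G$-space structure, is an amenable $\mathcal G$-space.
   Context: Locally compact spaces are Hausdorff by convention. A locally compact groupoid is a groupoid $\mathcal G$ with a locally compact topology for which the structure maps (range $r$, source $s$, inverse, product) are continuous; the unit space is $X=\mathcal G^{(0)}\subset\mathcal G$, and $\mathcal G^x=r^{-1}(x)$. An étale groupoid is a locally compact groupoid whose range map (hence also source map) is a local homeomorphism from $\mathcal G$ to $\mathcal G^{(0)}$. Amenable groupoid: a locally compact groupoid $\mathcal H$ is amenable if there is a net $(m_i)$, where each $m_i=(m_i^x)_{x\in\mathcal H^{(0)}}$ is a family of probability measures $m_i^x$ on $\mathcal H^x$, such that $x\mapsto m_i^x(f)$ is continuous for all $f\in C_c(\mathcal H)$, and $\lim_i\|\gamma m_i^{s(\gamma)}-m_i^{r(\gamma)}\|_1=0$ uniformly on every compact subset of $\mathcal H$. Fibre spaces: a fibre space over a locally compact space $X$ is a pair $(Y,p)$ with $Y$ locally compact and $p:Y\to X$ a continuous surjection. It is fibrewise compact if $p$ is proper, i.e. $p^{-1}(K)$ is compact for every compact $K\subset X$. $\mathcal G$-spaces: a (left) $\mathcal G$-space is a fibre space $(Y,p)$ over $X=\mathcal G^{(0)}$ with a continuous map $(\gamma,y)\mapsto\gamma y$ from $\{(\gamma,y)\in\mathcal G\times Y: s(\gamma)=p(y)\}$ to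 $Y$ such that $p(\gamma y)=r(\gamma)$, $p(y)y=y$, and $(\gamma_2\gamma_1)y=\gamma_2(\gamma_1y)$ whenever these are defined. The semidirect product groupoid $Y\rtimes\mathcal G$ is the space $\{(y,\gamma)\in Y\times \mathcal G: p(y)=r(\gamma)\}$ (with the topology induced by the product), with unit space $Y$, $r(y,\gamma)=y$, $s(y,\gamma)=\gamma^{-1}y$, $(y,\gamma)(\gamma^{-1}y,\eta)=(y,\gamma\eta)$, $(y,\gamma)^{-1}=(\gamma^{-1}y,\gamma^{-1})$. The $\mathcal G$-space $(Y,p)$ is amenable if the groupoid $Y\rtimes\mathcal G$ is amenable. Strong amenability at infinity: $\mathcal G$ is strongly amenable at infinity if there exists an amenable fibrewise compact $\mathcal G$-space $(Y,p)$ together with a continuous section $\sigma:X\to Y$ of $p$. Stone–Čech fibrewise compactification: for a fibre space $(Y,p)$ over $X$, let $C_0(Y,p)$ be the $C^*$-algebra of bounded continuous functions $g$ on $Y$ such that for every $\varepsilon>0$ there is a compact $K\subset X$ with $|g(y)|\le\varepsilon$ for $y\notin p^{-1}(K)$. Let $\beta_pY$ be its Gelfand spectrum, and let $p_\beta:\beta_pY\to X$ be the surjection dual to the inclusion $f\mapsto f\circ p$ of $C_0(X)$ into $C_0(Y,p)$. Then $(\beta_pY,p_\beta)$ is fibrewise compact and $Y$ embeds homeomorphically as an open dense subset with $p_\beta|_Y=p$. When $\mathcal G$ is étale and $(Y,p)$ is a $\mathcal G$-space, the $\mathcal G$-space structure of $(Y,p)$ extends in a unique way to a $\mathcal G$-space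 structure on $(\beta_pY,p_\beta)$ (a known fact). Here this is applied to $(Y,p)=(\mathcal G,r)$ with $\mathcal G$ acting on itself by left multiplication, which gives $(\beta_r\mathcal G,r_\beta)$. *)

theory Defs
  imports "HOL-Probability.Probability_Measure"
begin

section \<open>Locally compact and etale groupoids\<close>

text \<open>
  The underlying set of a groupoid is the \<open>topspace\<close> of its topology, and the unit space is the
  subset \<open>units G\<close> of it, so \<open>rng\<close> and \<open>src\<close> take values in the groupoid itself. The product
  \<open>gmult G g h\<close> is meaningful only when \<open>src G g = rng G h\<close>.
\<close>

record 'g groupoid =
  gtop :: "'g topology"
  rng :: "'g \<Rightarrow> 'g"
  src :: "'g \<Rightarrow> 'g"
  ginv :: "'g \<Rightarrow> 'g"
  gmult :: "'g \<Rightarrow> 'g \<Rightarrow> 'g"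

definition arrows :: "'g groupoid \<Rightarrow> 'g set" where
  "arrows G = topspace (gtop G)"

definition units :: "'g groupoid \<Rightarrow> 'g set" where
  "units G = rng G ` arrows G"

definition unit_space :: "'g groupoid \<Rightarrow> 'g topology" where
  "unit_space G = subtopology (gtop G) (units G)"

definition fibre_space :: "'g groupoid \<Rightarrow> 'g \<Rightarrow> 'g topology" where
  "fibre_space G x = subtopology (gtop G) {g \<in> arrows G. rng G g = x}"

definition is_groupoid :: "'g groupoid \<Rightarrow> bool" where
  "is_groupoid G \<longleftrightarrow>
     (\<forall>g\<in>arrows G. rng G g \<in> arrows G \<and> src G g \<in> arrows G \<and> ginv G g \<in> arrows G) \<and>
     (\<forall>g\<in>arrows G. rng G (rng G g) = rng G g \<and> src G (rng G g) = rng G g \<and>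
                   rng G (src G g) = src G g \<and> src G (src G g) = src G g) \<and>
     (\<forall>g\<in>arrows G. \<forall>h\<in>arrows G. src G g = rng G h \<longrightarrow>
        gmult G g h \<in> arrows G \<and> rng G (gmult G g h) = rng G g \<and> src G (gmult G g h) = src G h) \<and>
     (\<forall>g\<in>arrows G. \<forall>h\<in>arrows G. \<forall>k\<in>arrows G. src G g = rng G h \<and> src G h = rng G k \<longrightarrow>
        gmult G (gmult G g h) k = gmult G g (gmult G h k)) \<and>
     (\<forall>g\<in>arrows G. gmult G (rng G g) g = g \<and> gmult G g (src G g) = g) \<and>
     (\<forall>g\<in>arrows G. rng G (ginv G g) = src G g \<and> src G (ginv G g) = rng G g \<and>
                   gmult G g (ginv G g) = rng G g \<and> gmult G (ginv G g) g = src G g)"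

definition locally_compact_groupoid :: "'g groupoid \<Rightarrow> bool" where
  "locally_compact_groupoid G \<longleftrightarrow>
     is_groupoid G \<and>
     locally_compact_space (gtop G) \<and> Hausdorff_space (gtop G) \<and>
     continuous_map (gtop G) (gtop G) (rng G) \<and>
     continuous_map (gtop G) (gtop G) (src G) \<and>
     continuous_map (gtop G) (gtop G) (ginv G) \<and>
     continuous_map
       (subtopology (prod_topology (gtop G) (gtop G))
          {(g, h). g \<in> arrows G \<and> h \<in> arrows G \<and> src G g = rng G h})
       (gtop G) (\<lambda>(g, h). gmult G g h)"

definition local_homeomorphism :: "'a topology \<Rightarrow> 'b topology \<Rightarrow> ('a \<Rightarrow> 'b) \<Rightarrow> bool" where
  "local_homeomorphism S T f \<longleftrightarrow>
     (\<forall>x\<in>topspace S. \<exists>U. openin S U \<and> x \<in> U \<and> openin T (f ` U) \<and>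
        homeomorphic_map (subtopology S U) (subtopology T (f ` U)) f)"

definition etale_groupoid :: "'g groupoid \<Rightarrow> bool" where
  "etale_groupoid G \<longleftrightarrow>
     locally_compact_groupoid G \<and> local_homeomorphism (gtop G) (unit_space G) (rng G)"

section \<open>Amenable groupoids\<close>

definition borel_sigma :: "'a topology \<Rightarrow> 'a measure" where
  "borel_sigma T = sigma (topspace T) {U. openin T U}"

text \<open>
  On a locally compact space, which need not be second countable, measures are Radon measures.
  For finite Borel measures this amounts to inner regularity on all Borel sets.
\<close>

definition radon_prob_measure :: "'a topology \<Rightarrow> 'a measure \<Rightarrow> bool" where
  "radon_prob_measure T \<mu> \<longleftrightarrow>
     sets \<mu> = sets (borel_sigma T) \<and> prob_space \<mu> \<and>
     (\<forall>A\<in>sets \<mu>. emeasure \<mu> A = (SUP K\<in>{K. compactin T K \<and> K \<subseteq> A}. emeasure \<mu> K))"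

text \<open>The norm \<open>\<parallel>\<mu> - \<nu>\<parallel>\<^sub>1\<close>: the total variation of the signed measure \<open>\<mu> - \<nu>\<close>,
  for finite measures on the same measurable space.\<close>

definition norm1_diff :: "'a measure \<Rightarrow> 'a measure \<Rightarrow> real" where
  "norm1_diff \<mu> \<nu> =
     (SUP P\<in>{P. finite P \<and> partition_on (space \<mu>) P \<and> P \<subseteq> sets \<mu>}.
        \<Sum>A\<in>P. \<bar>measure \<mu> A - measure \<nu> A\<bar>)"

definition translate_measure :: "'g groupoid \<Rightarrow> 'g \<Rightarrow> 'g measure \<Rightarrow> 'g measure" where
  "translate_measure G g \<mu> = distr \<mu> (borel_sigma (fibre_space G (rng G g))) (gmult G g)"

definition compactly_supported :: "'a topology \<Rightarrow> ('a \<Rightarrow> complex) \<Rightarrow> bool" where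
  "compactly_supported T f \<longleftrightarrow>
     continuous_map T euclidean f \<and>
     (\<exists>K. compactin T K \<and> (\<forall>x\<in>topspace T - K. f x = 0))"

definition continuous_prob_family :: "'g groupoid \<Rightarrow> ('g \<Rightarrow> 'g measure) \<Rightarrow> bool" where
  "continuous_prob_family G m \<longleftrightarrow>
     (\<forall>x\<in>units G. radon_prob_measure (fibre_space G x) (m x)) \<and>
     (\<forall>f. compactly_supported (gtop G) f \<longrightarrow>
        continuous_map (unit_space G) euclidean (\<lambda>x. integral\<^sup>L (m x) f))"

definition directed_on :: "'i set \<Rightarrow> ('i \<Rightarrow> 'i \<Rightarrow> bool) \<Rightarrow> bool" where
  "directed_on I le \<longleftrightarrow>
     I \<noteq> {} \<and> (\<forall>i\<in>I. le i i) \<and>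
     (\<forall>i\<in>I. \<forall>j\<in>I. \<forall>k\<in>I. le i j \<and> le j k \<longrightarrow> le i k) \<and>
     (\<forall>i\<in>I. \<forall>j\<in>I. \<exists>k\<in>I. le i k \<and> le j k)"

definition amenability_net ::
  "'g groupoid \<Rightarrow> 'i set \<Rightarrow> ('i \<Rightarrow> 'i \<Rightarrow> bool) \<Rightarrow> ('i \<Rightarrow> 'g \<Rightarrow> 'g measure) \<Rightarrow> bool" where
  "amenability_net G I le m \<longleftrightarrow>
     directed_on I le \<and>
     (\<forall>i\<in>I. continuous_prob_family G (m i)) \<and>
     (\<forall>K. compactin (gtop G) K \<longrightarrow>
        (\<forall>\<epsilon>>0. \<exists>i0\<in>I. \<forall>i\<in>I. le i0 i \<longrightarrow>
           (\<forall>g\<in>K. norm1_diff (translate_measure G g (m i (src G g))) (m i (rng G g)) < \<epsilon>)))"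

text \<open>
  HOL cannot quantify over the type of the index set inside a definition. The type chosen here
  loses no generality: see \<open>amenableI\<close> below, where the index type is arbitrary.
\<close>

definition amenable :: "'g groupoid \<Rightarrow> bool" where
  "amenable G \<longleftrightarrow> (\<exists>(I :: ('g set \<times> nat) set) le m. amenability_net G I le m)"

lemma amenableI:
  fixes I :: "'i set"
  assumes "amenability_net G I le m"
  shows "amenable G"
proof -
  let ?J = "{K. compactin (gtop G) K} \<times> (UNIV :: nat set)"
  let ?le = "\<lambda>(K, n::nat) (K', n'). K \<subseteq> K' \<and> n \<le> n'"
  let ?Q = "\<lambda>\<epsilon> K i. i \<in> I \<and>
    (\<forall>g\<in>K. norm1_diff (translate_measure G g (m i (src G g))) (m i (rng G g)) < \<epsilon>)"
  have refl: "le i i" if "i \<in> I" for i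
    using assms that by (auto simp: amenability_net_def directed_on_def)
  have ex: "\<exists>i. ?Q \<epsilon> K i" if "compactin (gtop G) K" "\<epsilon> > 0" for K \<epsilon>
    using assms that refl unfolding amenability_net_def by meson
  define i where "i = (\<lambda>(K, n::nat). SOME i. ?Q (1 / Suc n) K i)"
  have i: "?Q (1 / Suc n) K (i (K, n))" if "compactin (gtop G) K" for K n
    unfolding i_def prod.case by (rule someI_ex, rule ex) (use that in auto)
  have dir: "directed_on ?J ?le"
    unfolding directed_on_def
  proof (intro conjI ballI impI)
    show "?J \<noteq> {}" by (auto intro: exI[of _ "{}"])
    fix a b assume "a \<in> ?J" "b \<in> ?J"
    then show "\<exists>c\<in>?J. ?le a c \<and> ?le b c"
      by (intro bexI[of _ "(fst a \<union> fst b, max (snd a) (snd b))"])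
        (auto intro: compactin_Un)
  qed auto
  have conv: "\<exists>a\<in>?J. \<forall>b\<in>?J. ?le a b \<longrightarrow>
      (\<forall>g\<in>K. norm1_diff (translate_measure G g (m (i b) (src G g))) (m (i b) (rng G g)) < \<epsilon>)"
    if K: "compactin (gtop G) K" and e: "\<epsilon> > 0" for K \<epsilon>
  proof -
    obtain n where n: "1 / real (Suc n) < \<epsilon>"
      using nat_approx_posE[OF e] by metis
    have *: "norm1_diff (translate_measure G g (m (i (L, k)) (src G g))) (m (i (L, k)) (rng G g)) < \<epsilon>"
      if "compactin (gtop G) L" "K \<subseteq> L" "n \<le> k" "g \<in> K" for L k g
    proof -
      have "norm1_diff (translate_measure G g (m (i (L, k)) (src G g))) (m (i (L, k)) (rng G g))
          < 1 / real (Suc k)" using i that by blast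
      also have "\<dots> \<le> 1 / real (Suc n)" using that by (simp add: field_simps)
      finally show ?thesis using n by linarith
    qed
    show ?thesis
      using K * by (intro bexI[of _ "(K, n)"]) auto
  qed
  have "amenability_net G ?J ?le (m \<circ> i)"
    unfolding amenability_net_def
  proof (intro conjI)
    show "\<forall>j\<in>?J. continuous_prob_family G ((m \<circ> i) j)"
      using assms i by (auto simp: amenability_net_def)
    show "\<forall>K. compactin (gtop G) K \<longrightarrow>
        (\<forall>\<epsilon>>0. \<exists>a\<in>?J. \<forall>b\<in>?J. ?le a b \<longrightarrow>
           (\<forall>g\<in>K. norm1_diff (translate_measure G g ((m \<circ> i) b (src G g)))
                     ((m \<circ> i) b (rng G g)) < \<epsilon>))"
      unfolding comp_def using conv by blast
  qed (rule dir)
  then show ?thesis unfolding amenable_def by blast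
qed

section \<open>Fibre spaces and groupoid actions\<close>

definition is_fibre_space :: "'x topology \<Rightarrow> 'y topology \<Rightarrow> ('y \<Rightarrow> 'x) \<Rightarrow> bool" where
  "is_fibre_space X Y p \<longleftrightarrow>
     locally_compact_space Y \<and> Hausdorff_space Y \<and>
     continuous_map Y X p \<and> p ` topspace Y = topspace X"

definition fibrewise_compact :: "'x topology \<Rightarrow> 'y topology \<Rightarrow> ('y \<Rightarrow> 'x) \<Rightarrow> bool" where
  "fibrewise_compact X Y p \<longleftrightarrow>
     is_fibre_space X Y p \<and>
     (\<forall>K. compactin X K \<longrightarrow> compactin Y {y \<in> topspace Y. p y \<in> K})"

definition is_gspace ::
  "'g groupoid \<Rightarrow> 'y topology \<Rightarrow> ('y \<Rightarrow> 'g) \<Rightarrow> ('g \<Rightarrow> 'y \<Rightarrow> 'y) \<Rightarrow> bool" where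
  "is_gspace G Y p a \<longleftrightarrow>
     is_fibre_space (unit_space G) Y p \<and>
     continuous_map
       (subtopology (prod_topology (gtop G) Y)
          {(g, y). g \<in> arrows G \<and> y \<in> topspace Y \<and> src G g = p y})
       Y (\<lambda>(g, y). a g y) \<and>
     (\<forall>g\<in>arrows G. \<forall>y\<in>topspace Y. src G g = p y \<longrightarrow> p (a g y) = rng G g) \<and>
     (\<forall>y\<in>topspace Y. a (p y) y = y) \<and>
     (\<forall>g2\<in>arrows G. \<forall>g1\<in>arrows G. \<forall>y\<in>topspace Y. src G g2 = rng G g1 \<and> src G g1 = p y \<longrightarrow>
        a (gmult G g2 g1) y = a g2 (a g1 y))"

text \<open>
  The unit space \<open>Y\<close> of \<open>Y \<rtimes> G\<close> sits inside it through \<open>y \<mapsto> (y, p y)\<close>; the range and source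
  \<open>y\<close> and \<open>\<gamma>\<^sup>-\<^sup>1 y\<close> of \<open>(y, \<gamma>)\<close> are written below as elements of the groupoid.
\<close>

definition semidirect ::
  "'g groupoid \<Rightarrow> 'y topology \<Rightarrow> ('y \<Rightarrow> 'g) \<Rightarrow> ('g \<Rightarrow> 'y \<Rightarrow> 'y) \<Rightarrow> ('y \<times> 'g) groupoid" where
  "semidirect G Y p a =
     \<lparr> gtop = subtopology (prod_topology Y (gtop G))
                {(y, g). y \<in> topspace Y \<and> g \<in> arrows G \<and> p y = rng G g},
       rng = (\<lambda>(y, g). (y, p y)),
       src = (\<lambda>(y, g). (a (ginv G g) y, p (a (ginv G g) y))),
       ginv = (\<lambda>(y, g). (a (ginv G g) y, ginv G g)),
       gmult = (\<lambda>(y, g) (z, h). (y, gmult G g h)) \<rparr>"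

definition amenable_gspace ::
  "'g groupoid \<Rightarrow> 'y topology \<Rightarrow> ('y \<Rightarrow> 'g) \<Rightarrow> ('g \<Rightarrow> 'y \<Rightarrow> 'y) \<Rightarrow> bool" where
  "amenable_gspace G Y p a \<longleftrightarrow> is_gspace G Y p a \<and> amenable (semidirect G Y p a)"

text \<open>The type argument is the type in which the points of the space \<open>Y\<close> are taken, since HOL
  cannot quantify over types inside a definition.\<close>

definition strongly_amenable_at_infinity :: "'y itself \<Rightarrow> 'g groupoid \<Rightarrow> bool" where
  "strongly_amenable_at_infinity _ G \<longleftrightarrow>
     (\<exists>(Y :: 'y topology) p a \<sigma>.
        amenable_gspace G Y p a \<and> fibrewise_compact (unit_space G) Y p \<and>
        continuous_map (unit_space G) Y \<sigma> \<and> (\<forall>x\<in>units G. p (\<sigma> x) = x))"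

section \<open>The Stone-Cech fibrewise compactification\<close>

text \<open>Functions on \<open>Y\<close> are represented by total functions that are 0 outside \<open>topspace Y\<close>.\<close>

definition C0_fib :: "'x topology \<Rightarrow> 'y topology \<Rightarrow> ('y \<Rightarrow> 'x) \<Rightarrow> ('y \<Rightarrow> complex) set" where
  "C0_fib X Y p =
     {g. continuous_map Y euclidean g \<and> (\<forall>y. y \<notin> topspace Y \<longrightarrow> g y = 0) \<and>
         bounded (g ` topspace Y) \<and>
         (\<forall>\<epsilon>>0. \<exists>K. compactin X K \<and> (\<forall>y\<in>topspace Y. p y \<notin> K \<longrightarrow> cmod (g y) \<le> \<epsilon>))}"

definition C0 :: "'x topology \<Rightarrow> ('x \<Rightarrow> complex) set" where
  "C0 X =
     {f. continuous_map X euclidean f \<and> (\<forall>x. x \<notin> topspace X \<longrightarrow> f x = 0) \<and>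
         (\<forall>\<epsilon>>0. \<exists>K. compactin X K \<and> (\<forall>x\<in>topspace X - K. cmod (f x) \<le> \<epsilon>))}"

text \<open>Gelfand spectrum of an algebra \<open>A\<close> of functions: the nonzero multiplicative linear
  functionals on \<open>A\<close>, with the topology of pointwise convergence on \<open>A\<close>.\<close>

definition characters :: "('y \<Rightarrow> complex) set \<Rightarrow> (('y \<Rightarrow> complex) \<Rightarrow> complex) set" where
  "characters A =
     {\<phi> \<in> extensional A.
        (\<forall>f\<in>A. \<forall>g\<in>A. \<phi> (\<lambda>y. f y + g y) = \<phi> f + \<phi> g) \<and>
        (\<forall>c. \<forall>f\<in>A. \<phi> (\<lambda>y. c * f y) = c * \<phi> f) \<and>
        (\<forall>f\<in>A. \<forall>g\<in>A. \<phi> (\<lambda>y. f y * g y) = \<phi> f * \<phi> g) \<and>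
        (\<exists>f\<in>A. \<phi> f \<noteq> 0)}"

definition gelfand_spectrum :: "('y \<Rightarrow> complex) set \<Rightarrow> (('y \<Rightarrow> complex) \<Rightarrow> complex) topology" where
  "gelfand_spectrum A = subtopology (product_topology (\<lambda>_. euclidean) A) (characters A)"

definition beta_space ::
  "'x topology \<Rightarrow> 'y topology \<Rightarrow> ('y \<Rightarrow> 'x) \<Rightarrow> (('y \<Rightarrow> complex) \<Rightarrow> complex) topology" where
  "beta_space X Y p = gelfand_spectrum (C0_fib X Y p)"

definition beta_proj ::
  "'x topology \<Rightarrow> 'y topology \<Rightarrow> ('y \<Rightarrow> 'x) \<Rightarrow> (('y \<Rightarrow> complex) \<Rightarrow> complex) \<Rightarrow> 'x" where
  "beta_proj X Y p \<phi> =
     (THE x. x \<in> topspace X \<and>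
        (\<forall>f\<in>C0 X. \<phi> (\<lambda>y. if y \<in> topspace Y then f (p y) else 0) = f x))"

definition beta_embed ::
  "'x topology \<Rightarrow> 'y topology \<Rightarrow> ('y \<Rightarrow> 'x) \<Rightarrow> 'y \<Rightarrow> (('y \<Rightarrow> complex) \<Rightarrow> complex)" where
  "beta_embed X Y p y = (\<lambda>g\<in>C0_fib X Y p. g y)"

text \<open>
  The \<open>G\<close>-space structure on \<open>\<beta>\<^sub>p Y\<close> that extends the one of \<open>Y\<close>. The first clause only fixes
  the values of the total function \<open>b\<close> where the action is not defined, to make \<open>b\<close> unique.
\<close>

definition beta_action ::
  "'g groupoid \<Rightarrow> 'y topology \<Rightarrow> ('y \<Rightarrow> 'g) \<Rightarrow> ('g \<Rightarrow> 'y \<Rightarrow> 'y) \<Rightarrow>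
   'g \<Rightarrow> (('y \<Rightarrow> complex) \<Rightarrow> complex) \<Rightarrow> (('y \<Rightarrow> complex) \<Rightarrow> complex)" where
  "beta_action G Y p a =
     (let X = unit_space G; Z = beta_space X Y p; q = beta_proj X Y p; \<iota> = beta_embed X Y p in
      THE b.
        (\<forall>g z. \<not> (g \<in> arrows G \<and> z \<in> topspace Z \<and> src G g = q z) \<longrightarrow> b g z = undefined) \<and>
        is_gspace G Z q b \<and>
        (\<forall>g\<in>arrows G. \<forall>y\<in>topspace Y. src G g = p y \<longrightarrow> b g (\<iota> y) = \<iota> (a g y)))"

text \<open>The case \<open>(Y, p) = (G, r)\<close>, with \<open>G\<close> acting on itself by left multiplication.\<close>

definition beta_r_space :: "'g groupoid \<Rightarrow> (('g \<Rightarrow> complex) \<Rightarrow> complex) topology" where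
  "beta_r_space G = beta_space (unit_space G) (gtop G) (rng G)"

definition r_beta :: "'g groupoid \<Rightarrow> (('g \<Rightarrow> complex) \<Rightarrow> complex) \<Rightarrow> 'g" where
  "r_beta G = beta_proj (unit_space G) (gtop G) (rng G)"

definition beta_r_action ::
  "'g groupoid \<Rightarrow> 'g \<Rightarrow> (('g \<Rightarrow> complex) \<Rightarrow> complex) \<Rightarrow> (('g \<Rightarrow> complex) \<Rightarrow> complex)" where
  "beta_r_action G = beta_action G (gtop G) (rng G) (gmult G)"

end

theory Submission
  imports Defs
begin

text \<open>
  Write \<open>X\<close> for the unit space of \<open>G\<close> and \<open>\<beta>\<close> for the fibrewise compactification of \<open>(G, r)\<close>.

  If the \<open>G\<close>-space \<open>\<beta>\<close> is amenable, it witnesses strong amenability at infinity itself: it is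
  fibrewise compact, and the embedding of \<open>G\<close> into \<open>\<beta>\<close>, restricted to \<open>X\<close>, is a continuous section.

  Conversely, let \<open>(Y, p)\<close> be an amenable fibrewise compact \<open>G\<close>-space with a section \<open>\<sigma>\<close>. The map
  \<open>\<gamma> \<mapsto> \<gamma> \<sigma>(s \<gamma>)\<close> from \<open>G\<close> to \<open>Y\<close> is equivariant and lies over \<open>X\<close>. As \<open>Y\<close> is fibrewise compact, it
  extends to a continuous equivariant map \<open>\<phi>\<close> from \<open>\<beta>\<close> to \<open>Y\<close>. The fibres of \<open>\<beta> \<rtimes> G\<close> over \<open>z\<close> and of
  \<open>Y \<rtimes> G\<close> over \<open>\<phi> z\<close> are both copies of \<open>{\<gamma>. r \<gamma> = r\<^sub>\<beta> z}\<close>, so the measures of an amenability net for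
  \<open>Y \<rtimes> G\<close> can be transported to \<open>\<beta> \<rtimes> G\<close>; equivariance of \<open>\<phi>\<close> preserves the norm estimate. This is
  \<open>amenable_pullback\<close>.

  The other half of the work is to know \<open>\<beta>\<close> well enough. Everything about the spectrum is derived
  from \<open>char_approx\<close>: on finitely many functions every character is approximated by
  evaluation at a point of the space. This gives density of the embedding, the base point of a
  character and, with Tychonoff's theorem, properness of the projection. The universal property of
  the compactification is proved in a form local over \<open>X\<close> (\<open>extension\<close>): a continuous map
  defined over an open \<open>U \<subseteq> X\<close> extends to the part of \<open>\<beta>\<close> over \<open>U\<close>, provided that it maps what lies
  over a compact subset of \<open>U\<close> into a compact set. It is used twice: for \<open>\<phi>\<close> with \<open>U = X\<close>, and to construct the
  \<open>G\<close>-action on \<open>\<beta>\<close>. For the latter, the source map of an etale groupoid has a local section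
  \<open>\<tau>\<close> through each arrow; translation along \<open>\<tau>\<close> is defined over the open domain of \<open>\<tau>\<close> and
  extends. Identities between the extended maps, and the uniqueness of the action, follow by density.
\<close>

section \<open>Cut-off functions and closed conditions\<close>

lemma continuous_map_mult:
  fixes f g :: "'a \<Rightarrow> 'b::real_normed_algebra"
  shows "continuous_map T euclidean f \<Longrightarrow> continuous_map T euclidean g
    \<Longrightarrow> continuous_map T euclidean (\<lambda>x. f x * g x)"
  by (simp add: continuous_map_atin tendsto_mult)

lemma continuous_map_compose_UNIV:
  assumes "continuous_map T euclidean f" "continuous_on UNIV h"
  shows "continuous_map T euclidean (\<lambda>x. h (f x))"
  using continuous_map_compose[OF assms(1), of euclidean h] assms(2) by (simp add: o_def)

lemma continuous_map_of_real:
  "continuous_map T euclideanreal f \<Longrightarrow> continuous_map T euclidean (\<lambda>x. complex_of_real (f x))"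
  by (rule continuous_map_compose_UNIV) (auto intro: continuous_intros)

lemma continuous_map_locally:
  assumes "\<And>x. x \<in> topspace S \<Longrightarrow>
    \<exists>U g. openin S U \<and> x \<in> U \<and> continuous_map (subtopology S U) T g \<and> (\<forall>y\<in>U. g y = f y)"
  shows "continuous_map S T f"
proof -
  have "\<exists>U. openin S U \<and> x \<in> U \<and> continuous_map (subtopology S U) T f" if x: "x \<in> topspace S" for x
  proof -
    obtain U g where "openin S U" "x \<in> U" "continuous_map (subtopology S U) T g" "\<forall>y\<in>U. g y = f y"
      using assms[OF x] by blast
    then show ?thesis using continuous_map_eq[of "subtopology S U" T g f] by auto
  qed
  then obtain U where U: "\<And>x. x \<in> topspace S \<Longrightarrow> openin S (U x) \<and> x \<in> U x \<and> continuous_map (subtopology S (U x)) T f"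
    by metis
  show ?thesis
    by (rule pasting_lemma[where I = "topspace S" and T = U and f = "\<lambda>_. f"]) (use U in auto)
qed

locale locally_compact_Hausdorff =
  fixes X :: "'x topology"
  assumes locally_compact: "locally_compact_space X"
    and Hausdorff: "Hausdorff_space X"
begin

lemma completely_regular: "completely_regular_space X"
  using locally_compact Hausdorff locally_compact_regular_imp_completely_regular_space by blast

lemma bump:
  assumes C: "compactin X C" and U: "openin X U" and CU: "C \<subseteq> U"
  obtains h :: "'x \<Rightarrow> real" and K where "continuous_map X euclideanreal h" "\<And>x. x \<in> C \<Longrightarrow> h x = 1"
    "\<And>x. x \<in> topspace X \<Longrightarrow> 0 \<le> h x \<and> h x \<le> 1"
    "compactin X K" "K \<subseteq> U" "\<And>x. x \<in> topspace X \<Longrightarrow> x \<notin> K \<Longrightarrow> h x = 0"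
proof -
  have "locally_compact_space (subtopology X U)" "Hausdorff_space (subtopology X U)"
    using locally_compact Hausdorff U locally_compact_Hausdorff_imp_regular_space
      locally_compact_space_open_subset Hausdorff_space_subtopology by blast+
  moreover have "compactin (subtopology X U) C" using C CU by (simp add: compactin_subtopology)
  ultimately obtain N K where "openin (subtopology X U) N" "compactin (subtopology X U) K" "C \<subseteq> N" "N \<subseteq> K"
    using locally_compact_space_compact_closed_compact[of "subtopology X U"] by blast
  then have NK: "openin X N" "compactin X K" "C \<subseteq> N" "N \<subseteq> K" "K \<subseteq> U"
    using U by (auto simp: compactin_subtopology intro: openin_trans_full)
  obtain f where f: "continuous_map X (top_of_set {0..1::real}) f" "f ` C \<subseteq> {1}" "f ` (topspace X - N) \<subseteq> {0}"
    using Urysohn_completely_regular_compact_closed[of 0 1 X C "topspace X - N"] completely_regular C NK(1,3)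
    by (metis Diff_disjoint closedin_diff closedin_topspace disjnt_def disjnt_subset1 zero_le_one)
  show thesis
  proof
    show "continuous_map X euclideanreal f"
      using f(1) by (auto simp: continuous_map_in_subtopology intro!: continuous_intros)
    show "f x = 1" if "x \<in> C" for x using f that by auto
    show "0 \<le> f x \<and> f x \<le> 1" if "x \<in> topspace X" for x
      using f(1) that by (auto simp: continuous_map_in_subtopology)
    show "f x = 0" if "x \<in> topspace X" "x \<notin> K" for x using f(3) NK that by auto
  qed (use NK in auto)
qed

lemma point_bump:
  assumes "x0 \<in> U" "openin X U"
  obtains h :: "'x \<Rightarrow> real" and K where "continuous_map X euclideanreal h" "h x0 = 1"
    "\<And>x. x \<in> topspace X \<Longrightarrow> 0 \<le> h x \<and> h x \<le> 1"
    "compactin X K" "K \<subseteq> U" "\<And>x. x \<in> topspace X \<Longrightarrow> x \<notin> K \<Longrightarrow> h x = 0"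
  using bump[of "{x0}" U] assms openin_subset[of X U] by (auto simp: subset_iff)

end

lemma closedin_Ball:
  assumes "\<And>i. i \<in> I \<Longrightarrow> closedin T {x \<in> topspace T. Q i x}"
  shows "closedin T {x \<in> topspace T. \<forall>i\<in>I. Q i x}"
proof (cases "I = {}")
  case False
  then have "{x \<in> topspace T. \<forall>i\<in>I. Q i x} = (\<Inter>i\<in>I. {x \<in> topspace T. Q i x})" by auto
  then show ?thesis using False assms by (auto intro!: closedin_INT)
qed auto

section \<open>The algebra of functions vanishing at infinity along the base\<close>

locale lc_fibre_space = locally_compact_Hausdorff X for X :: "'x topology" +
  fixes Y :: "'y topology" and p :: "'y \<Rightarrow> 'x"
  assumes fibre: "is_fibre_space X Y p"
begin

sublocale Y: locally_compact_Hausdorff Y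
  using fibre by unfold_locales (auto simp: is_fibre_space_def)

abbreviation A where "A \<equiv> C0_fib X Y p"
abbreviation Z where "Z \<equiv> beta_space X Y p"
abbreviation q where "q \<equiv> beta_proj X Y p"
abbreviation emb where "emb \<equiv> beta_embed X Y p"

lemma p_cont: "continuous_map Y X p"
  using fibre by (auto simp: is_fibre_space_def)

lemma p_in: "y \<in> topspace Y \<Longrightarrow> p y \<in> topspace X"
  using p_cont by (auto simp: continuous_map_def)

lemma A_zero_outside: "f \<in> A \<Longrightarrow> y \<notin> topspace Y \<Longrightarrow> f y = 0"
  by (auto simp: C0_fib_def)

lemma A_cont: "f \<in> A \<Longrightarrow> continuous_map Y euclidean f"
  by (auto simp: C0_fib_def)

lemma A_bounded: "f \<in> A \<Longrightarrow> \<exists>B. \<forall>y. cmod (f y) \<le> B"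
proof -
  assume f: "f \<in> A"
  then obtain B where "\<forall>y\<in>topspace Y. cmod (f y) \<le> B" by (auto simp: C0_fib_def bounded_iff)
  then have "cmod (f y) \<le> max B 0" for y using A_zero_outside[OF f, of y] by (cases "y \<in> topspace Y") auto
  then show ?thesis by blast
qed

lemma A_small: "f \<in> A \<Longrightarrow> \<epsilon> > 0 \<Longrightarrow> \<exists>K. compactin X K \<and> (\<forall>y. p y \<notin> K \<longrightarrow> cmod (f y) \<le> \<epsilon>)"
proof -
  assume f: "f \<in> A" and e: "\<epsilon> > 0"
  then obtain K where "compactin X K" "\<forall>y\<in>topspace Y. p y \<notin> K \<longrightarrow> cmod (f y) \<le> \<epsilon>"
    by (auto simp: C0_fib_def)
  then show ?thesis using A_zero_outside[OF f] e by (metis less_imp_le norm_zero)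
qed

lemma A_add: assumes f: "f \<in> A" and g: "g \<in> A" shows "(\<lambda>y. f y + g y) \<in> A"
  unfolding C0_fib_def
proof (intro CollectI conjI allI impI)
  show "continuous_map Y euclidean (\<lambda>y. f y + g y)"
    using f g A_cont continuous_map_add by blast
  show "f y + g y = 0" if "y \<notin> topspace Y" for y using A_zero_outside[OF f that] A_zero_outside[OF g that] by simp
  show "bounded ((\<lambda>y. f y + g y) ` topspace Y)"
    using f g bounded_plus_comp[of f "topspace Y" g] by (auto simp: C0_fib_def)
  fix \<epsilon> :: real assume "\<epsilon> > 0"
  then have e: "\<epsilon>/2 > 0" by simp
  obtain K L where K: "compactin X K" "\<forall>y. p y \<notin> K \<longrightarrow> cmod (f y) \<le> \<epsilon>/2"
    and L: "compactin X L" "\<forall>y. p y \<notin> L \<longrightarrow> cmod (g y) \<le> \<epsilon>/2"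
    using A_small[OF f e] A_small[OF g e] by metis
  have "cmod (f y + g y) \<le> \<epsilon>" if "p y \<notin> K \<union> L" for y
    using K(2)[rule_format, of y] L(2)[rule_format, of y] norm_triangle_ineq[of "f y" "g y"] that by simp
  then show "\<exists>K. compactin X K \<and> (\<forall>y\<in>topspace Y. p y \<notin> K \<longrightarrow> cmod (f y + g y) \<le> \<epsilon>)"
    using compactin_Un[OF K(1) L(1)] by blast
qed

text \<open>\<open>A\<close> is an ideal in the algebra of all bounded continuous functions. This lets \<open>char_approx\<close>
  divide an element of \<open>A\<close> by a function that is bounded away from 0.\<close>

lemma A_mult_bounded:
  assumes f: "f \<in> A" and g: "continuous_map Y euclidean g" "\<And>y. y \<in> topspace Y \<Longrightarrow> cmod (g y) \<le> B"
  shows "(\<lambda>y. g y * f y) \<in> A"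
  unfolding C0_fib_def
proof (intro CollectI conjI allI impI)
  show "continuous_map Y euclidean (\<lambda>y. g y * f y)"
    using f g A_cont continuous_map_mult by blast
  show "g y * f y = 0" if "y \<notin> topspace Y" for y using A_zero_outside[OF f that] by simp
  obtain C where C: "\<forall>y. cmod (f y) \<le> C" using A_bounded[OF f] by blast
  define M where "M = max B 1"
  have M: "M > 0" "\<And>y. y \<in> topspace Y \<Longrightarrow> cmod (g y) \<le> M" using g(2) by (auto simp: M_def) (smt (verit))
  have "cmod (g y * f y) \<le> M * C" if "y \<in> topspace Y" for y
    using M(2)[OF that] C M(1) by (simp add: norm_mult mult_mono)
  then show "bounded ((\<lambda>y. g y * f y) ` topspace Y)"
    by (auto simp: bounded_iff)
  fix \<epsilon> :: real assume "\<epsilon> > 0"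
  then have e: "\<epsilon>/M > 0" using M by simp
  obtain K where K: "compactin X K" "\<forall>y. p y \<notin> K \<longrightarrow> cmod (f y) \<le> \<epsilon>/M"
    using A_small[OF f e] by metis
  have "cmod (g y * f y) \<le> \<epsilon>" if "p y \<notin> K" "y \<in> topspace Y" for y
    using K(2)[rule_format, of y] M(2)[OF that(2)] M(1) that
      mult_mono[of "cmod (g y)" M "cmod (f y)" "\<epsilon>/M"] by (simp add: norm_mult)
  then show "\<exists>K. compactin X K \<and> (\<forall>y\<in>topspace Y. p y \<notin> K \<longrightarrow> cmod (g y * f y) \<le> \<epsilon>)"
    using K(1) by blast
qed

lemma A_mult: "f \<in> A \<Longrightarrow> g \<in> A \<Longrightarrow> (\<lambda>y. f y * g y) \<in> A"
  using A_bounded[of f] A_mult_bounded[of g f] A_cont[of f] by blast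

lemma A_scale: "f \<in> A \<Longrightarrow> (\<lambda>y. c * f y) \<in> A"
  using A_mult_bounded[of f "\<lambda>_. c" "cmod c"] by simp

lemma A_zero: "(\<lambda>_. 0) \<in> A"
  by (auto simp: C0_fib_def bounded_iff intro: exI[of _ "{}"])

lemma A_compact_base:
  assumes "continuous_map Y euclidean f" "\<And>y. y \<notin> topspace Y \<Longrightarrow> f y = 0"
    "\<And>y. y \<in> topspace Y \<Longrightarrow> cmod (f y) \<le> B"
    "compactin X K" "\<And>y. y \<in> topspace Y \<Longrightarrow> p y \<notin> K \<Longrightarrow> f y = 0"
  shows "f \<in> A"
  using assms unfolding C0_fib_def bounded_iff by fastforce

definition pullback :: "('x \<Rightarrow> complex) \<Rightarrow> 'y \<Rightarrow> complex" where
  "pullback f = (\<lambda>y. if y \<in> topspace Y then f (p y) else 0)"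

lemma pullback_in: assumes "f \<in> C0 X" shows "pullback f \<in> A"
proof -
  obtain K where K: "compactin X K" "\<forall>x\<in>topspace X - K. cmod (f x) \<le> 1"
    using assms zero_less_one unfolding C0_def by blast
  have "compactin euclidean (f ` K)"
    using assms K image_compactin unfolding C0_def by blast
  then have "bounded (f ` K)" using compact_imp_bounded by simp
  then obtain B where "\<forall>x\<in>K. cmod (f x) \<le> B"
    by (auto simp: bounded_iff)
  then have "\<forall>x\<in>topspace X. cmod (f x) \<le> max B 1" using K by (metis DiffI max.coboundedI1 max.coboundedI2)
  then have "bounded (pullback f ` topspace Y)"
    using p_in by (auto simp: bounded_iff pullback_def)
  moreover have "continuous_map Y euclidean (pullback f)"
    using continuous_map_compose[OF p_cont, of euclidean f] assms
    by (auto simp: C0_def pullback_def elim!: continuous_map_eq)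
  moreover have "\<exists>K. compactin X K \<and> (\<forall>y\<in>topspace Y. p y \<notin> K \<longrightarrow> cmod (pullback f y) \<le> \<epsilon>)" if e: "\<epsilon> > 0" for \<epsilon>
  proof -
    obtain K where "compactin X K" "\<forall>x\<in>topspace X - K. cmod (f x) \<le> \<epsilon>"
      using assms e unfolding C0_def by blast
    then show ?thesis using p_in by (intro exI[of _ K]) (auto simp: pullback_def)
  qed
  ultimately show ?thesis by (auto simp: C0_fib_def pullback_def)
qed

lemma C0_bump:
  assumes "compactin X C" "openin X U" "C \<subseteq> U"
  obtains h K where "h \<in> C0 X" "\<And>x. x \<in> C \<Longrightarrow> h x = 1" "\<And>x. x \<notin> K \<Longrightarrow> h x = 0"
    "\<And>x. cmod (h x) \<le> 1" "compactin X K" "K \<subseteq> U"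
proof -
  obtain h K where h: "continuous_map X euclideanreal h" "\<And>x. x \<in> C \<Longrightarrow> h x = 1"
    "\<And>x. x \<in> topspace X \<Longrightarrow> 0 \<le> h x \<and> h x \<le> 1"
    "compactin X K" "K \<subseteq> U" "\<And>x. x \<in> topspace X \<Longrightarrow> x \<notin> K \<Longrightarrow> h x = 0"
    using bump[OF assms] by blast
  define f where "f = (\<lambda>x. if x \<in> topspace X then complex_of_real (h x) else 0)"
  have C: "C \<subseteq> topspace X" using assms(1) compactin_subset_topspace by blast
  have "continuous_map X euclidean f"
    using continuous_map_of_real[OF h(1)] by (auto simp: f_def elim!: continuous_map_eq)
  moreover have "\<forall>\<epsilon>>0. \<exists>K. compactin X K \<and> (\<forall>x\<in>topspace X - K. cmod (f x) \<le> \<epsilon>)"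
    using h(4,6) by (intro allI impI exI[of _ K]) (auto simp: f_def)
  ultimately have "f \<in> C0 X" by (simp add: C0_def f_def)
  then show thesis using h C by (intro that[of f K]) (auto simp: f_def)
qed

lemma C0_point_bump:
  assumes "x0 \<in> U" "openin X U"
  obtains h K where "h \<in> C0 X" "h x0 = 1" "\<And>x. x \<notin> K \<Longrightarrow> h x = 0"
    "\<And>x. cmod (h x) \<le> 1" "compactin X K" "K \<subseteq> U"
  using C0_bump[of "{x0}" U] assms openin_subset[of X U] by (auto simp: subset_iff)

section \<open>Characters are limits of points\<close>

lemma topspace_Z: "topspace Z = characters A"
  by (auto simp: beta_space_def gelfand_spectrum_def characters_def PiE_UNIV_domain PiE_def)

lemma
  assumes "\<phi> \<in> characters A" "f \<in> A" 
  shows char_add: "g \<in> A \<Longrightarrow> \<phi> (\<lambda>y. f y + g y) = \<phi> f + \<phi> g"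
    and char_scale: "\<phi> (\<lambda>y. c * f y) = c * \<phi> f"
    and char_mult: "g \<in> A \<Longrightarrow> \<phi> (\<lambda>y. f y * g y) = \<phi> f * \<phi> g"
  using assms by (auto simp: characters_def)

lemma A_diff: assumes "f \<in> A" "g \<in> A" shows "(\<lambda>y. f y - g y) \<in> A"
  using A_add[OF assms(1) A_scale[OF assms(2), of "-1"]] by simp

lemma char_diff: assumes "\<phi> \<in> characters A" "f \<in> A" "g \<in> A" shows "\<phi> (\<lambda>y. f y - g y) = \<phi> f - \<phi> g"
  using char_add[OF assms(1,2) A_scale[OF assms(3), of "-1"]] char_scale[OF assms(1,3), of "-1"] by simp

lemma char_zero: assumes "\<phi> \<in> characters A" shows "\<phi> (\<lambda>_. 0) = 0"
  using char_scale[OF assms A_zero, of 0] by simp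

lemma char_sum: 
  assumes \<phi>: "\<phi> \<in> characters A" and "finite F" "\<And>f. f \<in> F \<Longrightarrow> u f \<in> A"
  shows "(\<lambda>y. \<Sum>f\<in>F. u f y) \<in> A \<and> \<phi> (\<lambda>y. \<Sum>f\<in>F. u f y) = (\<Sum>f\<in>F. \<phi> (u f))"
  using assms(2,3) by (induction F) (auto simp: A_zero char_zero[OF \<phi>] A_add char_add[OF \<phi>])

lemma char_unit:
  assumes \<phi>: "\<phi> \<in> characters A"
  obtains e where "e \<in> A" "\<phi> e = 1"
proof -
  obtain f where f: "f \<in> A" "\<phi> f \<noteq> 0" using \<phi> by (auto simp: characters_def)
  then show thesis using that[of "\<lambda>y. inverse (\<phi> f) * f y"] A_scale char_scale[OF \<phi>] by simp
qed

text \<open>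
  The reason is purely algebraic. If no point of \<open>Y\<close> came close to \<open>\<phi>\<close> on \<open>F\<close>, then for
  \<open>e\<close> with \<open>\<phi> e = 1\<close> the function
  \<open>k = \<bar>1 - e\<bar>\<^sup>2 + (\<Sum>f\<in>F. \<bar>f - \<phi> f \<cdot> e\<bar>\<^sup>2)\<close> would be bounded away from 0, hence \<open>e / k\<close> would
  belong to \<open>A\<close>; but \<open>k\<close> lies in the kernel of the extension of \<open>\<phi>\<close> to bounded functions, so
  that \<open>\<phi> e = \<phi> (k \<cdot> (e / k)) = 0\<close>.
\<close>

lemma char_approx:
  assumes \<phi>: "\<phi> \<in> characters A" and F: "finite F" "F \<subseteq> A" and \<epsilon>: "\<epsilon> > 0"
  obtains y where "y \<in> topspace Y" "\<And>f. f \<in> F \<Longrightarrow> cmod (f y - \<phi> f) < \<epsilon>"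
proof (rule ccontr)
  note near = that
  assume "\<not> thesis"
  then have far: "\<exists>f\<in>F. cmod (f y - \<phi> f) \<ge> \<epsilon>" if "y \<in> topspace Y" for y
    using that \<open>\<not> thesis\<close> near by (meson linorder_not_le)
  obtain e where e: "e \<in> A" "\<phi> e = 1" using char_unit[OF \<phi>] .
  define d where "d f y = f y - \<phi> f * e y" for f y
  define k where "k y = (cmod (1 - e y))\<^sup>2 + (\<Sum>f\<in>F. (cmod (d f y))\<^sup>2)" for y
  define M where "M = 1 + (\<Sum>f\<in>F. cmod (\<phi> f))"
  have M: "M \<ge> 1" "\<And>f. f \<in> F \<Longrightarrow> 1 + cmod (\<phi> f) \<le> M"
    using F(1) by (auto simp: M_def sum_nonneg intro: member_le_sum)
  \<comment> \<open>\<open>f - \<phi> f = d f - \<phi> f (1 - e)\<close>, so \<open>\<bar>1 - e\<bar> < \<delta>\<close> and \<open>\<bar>d f\<bar> < \<delta>\<close> would give \<open>\<bar>f - \<phi> f\<bar> < \<epsilon>\<close>.\<close>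
  define \<delta> where "\<delta> = \<epsilon> / M"
  have \<delta>: "\<delta> > 0" using \<epsilon> M by (simp add: \<delta>_def)
  have k_ge: "k y \<ge> \<delta>\<^sup>2" if y: "y \<in> topspace Y" for y
  proof (rule ccontr)
    assume k: "\<not> \<delta>\<^sup>2 \<le> k y"
    obtain f where f: "f \<in> F" "cmod (f y - \<phi> f) \<ge> \<epsilon>" using far[OF y] by blast
    have s: "(\<Sum>f\<in>F. (cmod (d f y))\<^sup>2) \<ge> 0" "(cmod (d f y))\<^sup>2 \<le> (\<Sum>f\<in>F. (cmod (d f y))\<^sup>2)"
      using F(1) f by (auto intro: sum_nonneg member_le_sum[where f = "\<lambda>f. (cmod (d f y))\<^sup>2"])
    have "(cmod (1 - e y))\<^sup>2 < \<delta>\<^sup>2" "(cmod (d f y))\<^sup>2 < \<delta>\<^sup>2"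
      using k s zero_le_power2[of "cmod (1 - e y)"] unfolding k_def by linarith+
    then have a: "cmod (1 - e y) < \<delta>" "cmod (d f y) < \<delta>" using \<delta> power2_less_imp_less less_imp_le by blast+
    have "f y - \<phi> f = d f y - \<phi> f * (1 - e y)" by (simp add: d_def algebra_simps)
    then have "cmod (f y - \<phi> f) \<le> cmod (d f y) + cmod (\<phi> f) * cmod (1 - e y)"
      by (metis norm_mult norm_triangle_ineq4)
    also have "\<dots> < \<delta> + cmod (\<phi> f) * \<delta>" using a by (intro add_less_le_mono mult_left_mono) auto
    also have "\<dots> = (1 + cmod (\<phi> f)) * \<delta>" by (simp add: algebra_simps)
    also have "\<dots> \<le> M * \<delta>" using M(2)[OF f(1)] \<delta> by (intro mult_right_mono) auto
    also have "\<dots> = \<epsilon>" using M by (simp add: \<delta>_def)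
    finally show False using f(2) by simp
  qed
  have dA: "d f \<in> A" if "f \<in> F" for f
    unfolding d_def using A_diff[of f "\<lambda>y. \<phi> f * e y"] A_scale[OF e(1)] that F(2) by auto
  have d0: "\<phi> (d f) = 0" if "f \<in> F" for f
    unfolding d_def using char_diff[OF \<phi>, of f "\<lambda>y. \<phi> f * e y"] A_scale[OF e(1)] char_scale[OF \<phi> e(1)] e(2) that F(2) by auto
  define u where "u y = complex_of_real (inverse (k y)) * e y" for y
  have "continuous_map Y euclideanreal k"
    unfolding k_def using A_cont[OF e(1)] A_cont[OF dA] F(1)
    by (intro continuous_intros continuous_map_sum) auto
  then have uA: "u \<in> A"
    unfolding u_def using k_ge \<delta>
    by (intro A_mult_bounded[OF e(1), where B = "inverse (\<delta>\<^sup>2)"] continuous_map_of_real continuous_map_real_inverse)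
      (auto simp: norm_inverse intro!: le_imp_inverse_le, fastforce+)
  have cnjA: "(\<lambda>y. cnj (g y) * u y) \<in> A" if g: "g \<in> A" for g
  proof -
    obtain B where "\<forall>y. cmod (g y) \<le> B" using A_bounded[OF g] by blast
    then show ?thesis using continuous_map_compose_UNIV[OF A_cont[OF g], of cnj]
      by (intro A_mult_bounded[OF uA, of _ B]) (auto intro!: continuous_intros)
  qed
  \<comment> \<open>\<open>k u\<close> is the sum of \<open>\<bar>1 - e\<bar>\<^sup>2 u = w - e w\<close> and the \<open>\<bar>d f\<bar>\<^sup>2 u = v f\<close>; the factors \<open>1 - e\<close>
    and \<open>d f\<close> make \<open>\<phi>\<close> vanish on each of them.\<close>
  define w where "w y = u y - cnj (e y) * u y" for y
  have wA: "w \<in> A" unfolding w_def using A_diff uA cnjA e(1) by blast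
  define v where "v f y = d f y * (cnj (d f y) * u y)" for f y
  have vA: "v f \<in> A" and v0: "\<phi> (v f) = 0" if "f \<in> F" for f
    unfolding v_def using A_mult[OF dA cnjA[OF dA]] char_mult[OF \<phi> dA cnjA[OF dA]] d0 that by auto
  have ewA: "(\<lambda>y. w y - e y * w y) \<in> A" using A_diff[OF wA A_mult[OF e(1) wA]] .
  have ew0: "\<phi> (\<lambda>y. w y - e y * w y) = 0"
    using char_diff[OF \<phi> wA A_mult[OF e(1) wA]] char_mult[OF \<phi> e(1) wA] e(2) by simp
  have "e y = (w y - e y * w y) + (\<Sum>f\<in>F. v f y)" for y
  proof (cases "y \<in> topspace Y")
    case True
    then have k: "k y \<noteq> 0" using k_ge[OF True] \<delta> by (metis not_le zero_less_power)
    have "(w y - e y * w y) + (\<Sum>f\<in>F. v f y) = ((1 - e y) * cnj (1 - e y) + (\<Sum>f\<in>F. d f y * cnj (d f y))) * u y"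
      by (simp add: w_def v_def algebra_simps sum_distrib_left)
    also have "\<dots> = complex_of_real (k y) * u y"
      unfolding k_def complex_norm_square[symmetric] by (simp flip: complex_norm_square)
    finally show ?thesis using k by (simp add: u_def)
  qed (simp add: w_def v_def A_zero_outside[OF e(1)] A_zero_outside[OF uA])
  then have "\<phi> e = \<phi> (\<lambda>y. (w y - e y * w y) + (\<Sum>f\<in>F. v f y))" by presburger
  also have "\<dots> = 0"
    using char_add[OF \<phi> ewA, of "\<lambda>y. \<Sum>f\<in>F. v f y"] char_sum[OF \<phi> F(1), of v] vA v0 ew0 by simp
  finally show False using e(2) by simp
qed

lemma eval_cont: "f \<in> A \<Longrightarrow> continuous_map Z euclidean (\<lambda>\<phi>. \<phi> f)"
  unfolding beta_space_def gelfand_spectrum_def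
  by (intro continuous_map_from_subtopology continuous_map_product_projection)

lemma eval_open: "f \<in> A \<Longrightarrow> open S \<Longrightarrow> openin Z {\<phi> \<in> topspace Z. \<phi> f \<in> S}"
  using openin_continuous_map_preimage[OF eval_cont, of f S] by simp

lemma emb_eval: "f \<in> A \<Longrightarrow> emb y f = f y"
  by (simp add: beta_embed_def)

text \<open>In spite of vanishing at infinity along \<open>X\<close>, the functions in \<open>A\<close> separate points from closed
  sets of \<open>Y\<close>; hence the embedding is a homeomorphism onto its image.\<close>

lemma separating_function:
  assumes "y0 \<in> V" "openin Y V"
  obtains F where "F \<in> A" "F y0 = 1" "\<And>y. y \<notin> V \<Longrightarrow> F y = 0"
proof -
  have y0: "y0 \<in> topspace Y" using assms openin_subset by blast
  obtain h where h: "h \<in> C0 X" "h (p y0) = 1" using C0_point_bump[OF p_in[OF y0] openin_topspace] by metis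
  obtain k where k: "continuous_map Y euclideanreal k" "k y0 = 1"
    "\<And>y. y \<in> topspace Y \<Longrightarrow> 0 \<le> k y \<and> k y \<le> 1" "\<And>y. y \<in> topspace Y \<Longrightarrow> y \<notin> V \<Longrightarrow> k y = 0"
    using Y.point_bump[OF assms] by (metis subsetD)
  have "(\<lambda>y. complex_of_real (k y) * pullback h y) \<in> A"
    using k by (intro A_mult_bounded[OF pullback_in[OF h(1)], of _ 1] continuous_map_of_real) auto
  then show thesis by (rule that) (use k h y0 in \<open>auto simp: pullback_def\<close>)
qed

lemma emb_in: assumes y: "y \<in> topspace Y" shows "emb y \<in> topspace Z"
proof -
  obtain F where "F \<in> A" "F y = 1" using separating_function[OF y] by auto
  then have "\<exists>f\<in>A. emb y f \<noteq> 0" by (intro bexI[of _ F]) (auto simp: emb_eval)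
  then show ?thesis
    by (auto simp: topspace_Z characters_def beta_embed_def A_add A_scale A_mult)
qed

lemma emb_cont: "continuous_map Y Z emb"
  unfolding beta_space_def gelfand_spectrum_def continuous_map_in_subtopology
proof
  show "continuous_map Y (product_topology (\<lambda>_. euclidean) A) emb"
    by (auto simp: continuous_map_componentwise beta_embed_def intro: A_cont)
  show "emb \<in> topspace Y \<rightarrow> characters A" using emb_in topspace_Z by auto
qed

text \<open>A basic open set of the spectrum restricts the values at finitely many functions only, so
  \<open>char_approx\<close> finds a point of \<open>Y\<close> in it.\<close>

lemma emb_dense:
  assumes N: "openin Z N" and \<phi>: "\<phi> \<in> N"
  shows "\<exists>y\<in>topspace Y. emb y \<in> N"
proof -
  have \<phi>c: "\<phi> \<in> characters A" using assms openin_subset topspace_Z by blast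
  obtain N' where N': "openin (product_topology (\<lambda>_. euclidean) A) N'" "N = N' \<inter> characters A"
    using N unfolding beta_space_def gelfand_spectrum_def openin_subtopology by blast
  obtain U where U: "finite {f \<in> A. U f \<noteq> UNIV}" "\<And>f. f \<in> A \<Longrightarrow> open (U f)"
     "\<phi> \<in> PiE A U" "PiE A U \<subseteq> N'"
  proof -
    have "\<forall>x\<in>N'. \<exists>U. finite {i \<in> A. U i \<noteq> topspace (euclidean :: complex topology)} \<and>
        (\<forall>i\<in>A. openin euclidean (U i)) \<and> x \<in> PiE A U \<and> PiE A U \<subseteq> N'"
      using N'(1) by (simp only: openin_product_topology_alt)
    moreover have "\<phi> \<in> N'" using \<phi> N'(2) by blast
    ultimately obtain U where "finite {i \<in> A. U i \<noteq> topspace (euclidean :: complex topology)}"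
        "\<forall>i\<in>A. openin euclidean (U i)" "\<phi> \<in> PiE A U" "PiE A U \<subseteq> N'"
      by (rule bspec[elim_format]) (elim exE conjE)
    then show thesis by (intro that[of U]) auto
  qed
  define F where "F = {f \<in> A. U f \<noteq> UNIV}"
  have "\<forall>f\<in>F. \<exists>e>0. ball (\<phi> f) e \<subseteq> U f"
    using U(2,3) openE unfolding F_def by (metis (no_types, lifting) PiE_mem mem_Collect_eq)
  then obtain e where e: "\<And>f. f \<in> F \<Longrightarrow> e f > 0 \<and> ball (\<phi> f) (e f) \<subseteq> U f" by metis
  define \<epsilon> where "\<epsilon> = Min (insert 1 (e ` F))"
  have fin: "finite F" "F \<subseteq> A" using U(1) by (auto simp: F_def)
  have \<epsilon>: "\<epsilon> > 0" "\<And>f. f \<in> F \<Longrightarrow> \<epsilon> \<le> e f"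
    using fin e by (auto simp: \<epsilon>_def Min_gr_iff)
  obtain y where y: "y \<in> topspace Y" "\<And>f. f \<in> F \<Longrightarrow> cmod (f y - \<phi> f) < \<epsilon>"
    using char_approx[OF \<phi>c fin \<epsilon>(1)] by blast
  have "f y \<in> U f" if f: "f \<in> A" for f
  proof (cases "f \<in> F")
    case True
    then have "f y \<in> ball (\<phi> f) (e f)"
      using y(2) \<epsilon>(2) by (metis dist_commute dist_norm dual_order.strict_trans1 mem_ball)
    then show ?thesis using e[OF True] by blast
  qed (use f F_def in auto)
  then have "emb y \<in> PiE A U" by (auto simp: beta_embed_def)
  then show ?thesis using y(1) U(4) N'(2) emb_in[OF y(1)] topspace_Z by blast
qed

lemma char_bound:
  assumes \<phi>: "\<phi> \<in> characters A" and f: "f \<in> A" and B: "\<And>y. cmod (f y) \<le> B"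
  shows "cmod (\<phi> f) \<le> B"
proof (rule field_le_epsilon)
  fix e :: real assume "e > 0"
  then obtain y where "cmod (f y - \<phi> f) < e" using char_approx[OF \<phi>, of "{f}"] f by auto
  then show "cmod (\<phi> f) \<le> B + e" using B[of y] norm_triangle_sub[of "\<phi> f" "f y"]
    by (simp add: norm_minus_commute)
qed

section \<open>The projection of the fibrewise compactification\<close>

text \<open>
  A character with no base point would be told apart from each \<open>x\<close> in a compact set \<open>K\<close> by one
  function, hence, by compactness, from all of \<open>K\<close> by finitely many of them; a point of \<open>Y\<close> close
  to the character on these and on a function that is small off \<open>p\<^sup>-\<^sup>1 K\<close> cannot exist.
\<close>

lemma base_point_exists:
  assumes \<phi>: "\<phi> \<in> characters A"
  shows "\<exists>x\<in>topspace X. \<forall>f\<in>C0 X. \<phi> (pullback f) = f x"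
proof (rule ccontr)
  assume neg: "\<not> ?thesis"
  obtain f0 where f0: "f0 \<in> A" "\<phi> f0 = 1" using char_unit[OF \<phi>] .
  obtain K where K: "compactin X K" "\<And>y. p y \<notin> K \<Longrightarrow> cmod (f0 y) \<le> 1/2"
    using A_small[OF f0(1), of "1/2"] by auto
  have "\<forall>x\<in>topspace X. \<exists>f\<in>C0 X. \<phi> (pullback f) \<noteq> f x" using neg by blast
  then obtain g where g: "\<And>x. x \<in> topspace X \<Longrightarrow> g x \<in> C0 X \<and> \<phi> (pullback (g x)) \<noteq> g x x" by metis
  define \<delta> where "\<delta> x = cmod (g x x - \<phi> (pullback (g x))) / 2" for x
  define O' where "O' x = {x' \<in> topspace X. g x x' \<in> - cball (\<phi> (pullback (g x))) (\<delta> x)}" for x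
  have KX: "K \<subseteq> topspace X" using K(1) compactin_subset_topspace by blast
  have \<delta>: "\<delta> x > 0" if "x \<in> K" for x using g[of x] KX that by (auto simp: \<delta>_def)
  have "openin X (O' x)" if "x \<in> K" for x
    unfolding O'_def using g[of x] that KX
    by (intro openin_continuous_map_preimage[where Y = euclidean]) (auto simp: C0_def)
  moreover have "x \<in> O' x" if "x \<in> K" for x
    using KX \<delta>[OF that] that by (auto simp: O'_def \<delta>_def dist_norm norm_minus_commute)
  ultimately obtain D where D: "finite D" "D \<subseteq> K" "K \<subseteq> (\<Union>x\<in>D. O' x)"
    using K(1) unfolding compactin_def by (smt (verit) UN_I finite_subset_image imageE subsetI)
  define F where "F = insert f0 ((\<lambda>x. pullback (g x)) ` D)"
  define \<epsilon> where "\<epsilon> = Min (insert (1/2) (\<delta> ` D))"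
  have F: "finite F" "F \<subseteq> A" using D f0 g pullback_in KX by (auto simp: F_def)
  have "\<epsilon> > 0" unfolding \<epsilon>_def using D(1,2) \<delta> by (subst Min_gr_iff) auto
  moreover have "\<epsilon> \<le> e" if "e \<in> insert (1/2) (\<delta> ` D)" for e
    unfolding \<epsilon>_def by (rule Min_le) (use D(1) that in auto)
  ultimately have \<epsilon>: "\<epsilon> > 0" "\<epsilon> \<le> 1/2" "\<And>x. x \<in> D \<Longrightarrow> \<epsilon> \<le> \<delta> x" by blast+
  obtain y where y: "y \<in> topspace Y" "\<And>f. f \<in> F \<Longrightarrow> cmod (f y - \<phi> f) < \<epsilon>"
    using char_approx[OF \<phi> F \<epsilon>(1)] by blast
  have "cmod (f0 y - 1) < 1/2" using y(2)[of f0] f0(2) \<epsilon>(2) by (auto simp: F_def)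
  then have "cmod (f0 y) > 1/2" using norm_triangle_sub[of 1 "f0 y"] by (simp add: norm_minus_commute)
  then have "p y \<in> K" using K(2)[of y] by linarith
  then obtain x where x: "x \<in> D" "p y \<in> O' x" using D by blast
  then have "cmod (pullback (g x) y - \<phi> (pullback (g x))) > \<delta> x"
    using y(1) by (auto simp: O'_def dist_norm norm_minus_commute pullback_def)
  moreover have "cmod (pullback (g x) y - \<phi> (pullback (g x))) < \<epsilon>"
    by (intro y(2)) (use x in \<open>auto simp: F_def\<close>)
  ultimately show False using \<epsilon>(3)[OF x(1)] by linarith
qed

lemma C0_separates:
  assumes "x \<in> topspace X" "x' \<in> topspace X" "\<And>f. f \<in> C0 X \<Longrightarrow> f x = f x'"
  shows "x = x'"
proof (rule ccontr)
  assume "x \<noteq> x'"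
  then have "openin X (topspace X - {x'})" "x \<in> topspace X - {x'}"
    using assms Hausdorff by (auto simp: closedin_Hausdorff_sing_eq intro!: openin_diff)
  then obtain h K where h: "h \<in> C0 X" "h x = 1" "\<And>x. x \<notin> K \<Longrightarrow> h x = 0" "K \<subseteq> topspace X - {x'}"
    using C0_point_bump by metis
  then have "h x' = 0" by blast
  then show False using assms(3)[OF h(1)] h(2) by simp
qed

lemma q_eqI:
  assumes x: "x \<in> topspace X" and eq: "\<And>f. f \<in> C0 X \<Longrightarrow> \<phi> (pullback f) = f x"
  shows "q \<phi> = x"
  unfolding beta_proj_def pullback_def[symmetric]
proof (rule the_equality)
  show "x \<in> topspace X \<and> (\<forall>f\<in>C0 X. \<phi> (pullback f) = f x)" using x eq by blast
  show "x' = x" if "x' \<in> topspace X \<and> (\<forall>f\<in>C0 X. \<phi> (pullback f) = f x')" for x'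
    by (rule C0_separates) (use that x eq in auto)
qed

lemma q_in: "\<phi> \<in> topspace Z \<Longrightarrow> q \<phi> \<in> topspace X"
  and q_eval: "\<phi> \<in> topspace Z \<Longrightarrow> f \<in> C0 X \<Longrightarrow> \<phi> (pullback f) = f (q \<phi>)"
  using base_point_exists q_eqI topspace_Z by metis+

lemma q_emb: "y \<in> topspace Y \<Longrightarrow> q (emb y) = p y"
  by (intro q_eqI) (auto simp: p_in emb_eval pullback_in, simp add: pullback_def)

lemma q_cont: "continuous_map Z X q"
  unfolding continuous_map_def
proof (intro conjI allI impI)
  show "q \<in> topspace Z \<rightarrow> topspace X" using q_in by auto
  fix U assume U: "openin X U"
  show "openin Z {\<phi> \<in> topspace Z. q \<phi> \<in> U}"
  proof (subst openin_subopen, safe)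
    fix \<phi> assume \<phi>: "\<phi> \<in> topspace Z" "q \<phi> \<in> U"
    obtain h K where h: "h \<in> C0 X" "h (q \<phi>) = 1" "\<And>x. x \<notin> K \<Longrightarrow> h x = 0" "K \<subseteq> U"
      using C0_point_bump[OF \<phi>(2) U] by metis
    let ?N = "{\<psi> \<in> topspace Z. \<psi> (pullback h) \<in> - {0}}"
    have "openin Z ?N" by (intro eval_open pullback_in h(1)) auto
    moreover have "\<phi> \<in> ?N" using \<phi>(1) h(2) q_eval[OF \<phi>(1) h(1)] by auto
    moreover have "q \<psi> \<in> U" if "\<psi> \<in> ?N" for \<psi>
    proof -
      have "h (q \<psi>) \<noteq> 0" using q_eval[OF _ h(1), of \<psi>] that by auto
      then show ?thesis using h(3,4) by blast
    qed
    then have "?N \<subseteq> {\<phi> \<in> topspace Z. q \<phi> \<in> U}" by blast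
    ultimately show "\<exists>T. openin Z T \<and> \<phi> \<in> T \<and> T \<subseteq> {\<phi> \<in> topspace Z. q \<phi> \<in> U}" by blast
  qed
qed

lemma open_over: "openin X U \<Longrightarrow> openin Z {z \<in> topspace Z. q z \<in> U}"
  by (rule openin_continuous_map_preimage[OF q_cont])

lemma Z_Hausdorff: "Hausdorff_space Z"
  unfolding beta_space_def gelfand_spectrum_def
  by (intro Hausdorff_space_subtopology) (simp add: Hausdorff_space_product_topology)

text \<open>Away from the zero functional the conditions defining characters are closed, and all
  values are bounded by sup norms, so Tychonoff's theorem applies.\<close>

lemma compact_where_large:
  assumes h: "h \<in> A"
  shows "compactin Z {\<phi> \<in> topspace Z. cmod (\<phi> h) \<ge> 1/2}"
proof -
  let ?P = "product_topology (\<lambda>_. euclidean :: complex topology) A"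
  obtain B where B: "\<And>f. f \<in> A \<Longrightarrow> \<forall>y. cmod (f y) \<le> B f" using A_bounded by metis
  define D where "D = PiE A (\<lambda>f. cball (0::complex) (B f))"
  have ev: "continuous_map ?P euclidean (\<lambda>\<phi>. \<phi> f)" if "f \<in> A" for f
    using that by (rule continuous_map_product_projection)
  have eq: "closedin ?P {\<phi> \<in> topspace ?P. l \<phi> = r \<phi>}"
    if "continuous_map ?P euclidean l" "continuous_map ?P euclidean r"
    for l r :: "(('y \<Rightarrow> complex) \<Rightarrow> complex) \<Rightarrow> complex"
    by (rule closedin_continuous_maps_eq[OF Hausdorff_space_euclidean that])
  have 1: "closedin ?P {\<phi> \<in> topspace ?P. \<forall>f\<in>A. \<forall>g\<in>A. \<phi> (\<lambda>y. f y + g y) = \<phi> f + \<phi> g}"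
    by (intro closedin_Ball eq continuous_map_add ev A_add)
  have 2: "closedin ?P {\<phi> \<in> topspace ?P. \<forall>c\<in>UNIV. \<forall>f\<in>A. \<phi> (\<lambda>y. c * f y) = c * \<phi> f}"
    by (intro closedin_Ball eq continuous_map_mult continuous_map_canonical_const ev A_scale)
  have 3: "closedin ?P {\<phi> \<in> topspace ?P. \<forall>f\<in>A. \<forall>g\<in>A. \<phi> (\<lambda>y. f y * g y) = \<phi> f * \<phi> g}"
    by (intro closedin_Ball eq continuous_map_mult ev A_mult)
  have 4: "closedin ?P {\<phi> \<in> topspace ?P. \<phi> h \<in> - ball 0 (1/2)}"
    by (rule closedin_continuous_map_preimage[OF ev[OF h]]) auto
  have comp: "compactin ?P D" unfolding D_def compactin_PiE by auto
  let ?S = "{\<phi> \<in> topspace Z. cmod (\<phi> h) \<ge> 1/2}"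
  have "?S = {\<phi> \<in> topspace ?P. \<forall>f\<in>A. \<forall>g\<in>A. \<phi> (\<lambda>y. f y + g y) = \<phi> f + \<phi> g} \<inter>
      {\<phi> \<in> topspace ?P. \<forall>c\<in>UNIV. \<forall>f\<in>A. \<phi> (\<lambda>y. c * f y) = c * \<phi> f} \<inter>
      {\<phi> \<in> topspace ?P. \<forall>f\<in>A. \<forall>g\<in>A. \<phi> (\<lambda>y. f y * g y) = \<phi> f * \<phi> g} \<inter>
      {\<phi> \<in> topspace ?P. \<phi> h \<in> - ball 0 (1/2)} \<inter> D" (is "_ = ?R")
  proof (intro set_eqI iffI)
    fix \<phi> assume \<phi>: "\<phi> \<in> ?S"
    have "\<phi> f \<in> cball 0 (B f)" if "f \<in> A" for f
      using char_bound[of \<phi> f] B that \<phi> topspace_Z by auto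
    then show "\<phi> \<in> ?R" using \<phi> by (auto simp: topspace_Z characters_def D_def PiE_def)
  next
    fix \<phi> assume \<phi>: "\<phi> \<in> ?R"
    then have "\<phi> h \<noteq> 0" by auto
    then show "\<phi> \<in> ?S" using \<phi> h by (auto simp: topspace_Z characters_def PiE_def)
  qed
  then have "compactin ?P ?S"
    using 1 2 3 4 comp by (simp add: closed_Int_compactin closedin_Int)
  then have "compactin (subtopology ?P (characters A)) ?S"
    by (intro iffD2[OF compactin_subtopology] conjI) (auto simp: topspace_Z)
  then show ?thesis unfolding beta_space_def gelfand_spectrum_def .
qed

lemma Z_locally_compact: "locally_compact_space Z"
  unfolding locally_compact_space_def
proof
  fix \<phi> assume \<phi>: "\<phi> \<in> topspace Z"
  then obtain e where e: "e \<in> A" "\<phi> e = 1" using char_unit topspace_Z by metis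
  have "openin Z {\<psi> \<in> topspace Z. \<psi> e \<in> - cball 0 (1/2)}" by (intro eval_open e) auto
  moreover have "{\<psi> \<in> topspace Z. \<psi> e \<in> - cball 0 (1/2)} \<subseteq> {\<psi> \<in> topspace Z. cmod (\<psi> e) \<ge> 1/2}" by auto
  moreover have "\<phi> \<in> {\<psi> \<in> topspace Z. \<psi> e \<in> - cball 0 (1/2)}" using \<phi> e by auto
  ultimately show "\<exists>U K. openin Z U \<and> compactin Z K \<and> \<phi> \<in> U \<and> U \<subseteq> K"
    using compact_where_large[OF e(1)] by blast
qed

lemma Z_locally_compact_Hausdorff: "locally_compact_Hausdorff Z"
  by unfold_locales (fact Z_locally_compact Z_Hausdorff)+

text \<open>A character over \<open>K\<close> takes the value 1 at \<open>h \<circ> p\<close> when \<open>h = 1\<close> on \<open>K\<close>, so it stays away from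
  the zero functional.\<close>

lemma q_proper:
  assumes K: "compactin X K"
  shows "compactin Z {\<phi> \<in> topspace Z. q \<phi> \<in> K}"
proof -
  obtain h where h: "h \<in> C0 X" "\<And>x. x \<in> K \<Longrightarrow> h x = 1"
    using C0_bump[OF K openin_topspace compactin_subset_topspace[OF K]] by metis
  have "{\<phi> \<in> topspace Z. q \<phi> \<in> K} \<subseteq> {\<phi> \<in> topspace Z. cmod (\<phi> (pullback h)) \<ge> 1/2}"
    using h(2) by (auto simp: q_eval[OF _ h(1)])
  moreover have "closedin Z {\<phi> \<in> topspace Z. q \<phi> \<in> K}"
    using closedin_continuous_map_preimage[OF q_cont] K Hausdorff compactin_imp_closedin by blast
  ultimately show ?thesis using closed_compactin compact_where_large pullback_in h(1) by blast
qed

lemma beta_fibrewise_compact: "fibrewise_compact X Z q"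
proof -
  have "q ` topspace Z = topspace X"
  proof (intro equalityI subsetI)
    fix x assume "x \<in> topspace X"
    then obtain y where "y \<in> topspace Y" "x = p y" using fibre by (auto simp: is_fibre_space_def)
    then show "x \<in> q ` topspace Z" using q_emb emb_in by (metis imageI)
  qed (use q_in in auto)
  then show ?thesis
    using Z_locally_compact Z_Hausdorff q_cont q_proper
    by (auto simp: fibrewise_compact_def is_fibre_space_def)
qed

section \<open>Extension of maps to the fibrewise compactification\<close>

lemma emb_inj: assumes "y \<in> topspace Y" "y' \<in> topspace Y" "emb y = emb y'" shows "y = y'"
proof (rule ccontr)
  assume "y \<noteq> y'"
  then have "openin Y (topspace Y - {y'})" "y \<in> topspace Y - {y'}"
    using assms Y.Hausdorff by (auto simp: closedin_Hausdorff_sing_eq intro!: openin_diff)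
  then obtain F where F: "F \<in> A" "F y = 1" "\<And>x. x \<notin> topspace Y - {y'} \<Longrightarrow> F x = 0"
    using separating_function by metis
  then have "F y' = 0" by blast
  then show False using assms(3) emb_eval[OF F(1)] F(2) by (metis zero_neq_one)
qed

lemma emb_open_onto_image:
  assumes V: "openin Y V" and y: "y \<in> V"
  obtains N where "openin Z N" "emb y \<in> N" "\<And>y'. y' \<in> topspace Y \<Longrightarrow> emb y' \<in> N \<Longrightarrow> y' \<in> V"
proof -
  have yY: "y \<in> topspace Y" using V y openin_subset by blast
  obtain F where F: "F \<in> A" "F y = 1" "\<And>y. y \<notin> V \<Longrightarrow> F y = 0" using separating_function[OF y V] by blast
  show thesis
  proof
    show "openin Z {\<phi> \<in> topspace Z. \<phi> F \<in> - {0}}" by (intro eval_open F) auto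
    show "emb y \<in> {\<phi> \<in> topspace Z. \<phi> F \<in> - {0}}" using F emb_in[OF yY] by (simp add: emb_eval)
    show "y' \<in> V" if "emb y' \<in> {\<phi> \<in> topspace Z. \<phi> F \<in> - {0}}" for y'
      using that F by (auto simp: emb_eval)
  qed
qed

text \<open>Stated over open subsets of \<open>X\<close>, because local sections of the source map, to which it will be
  applied, are defined on such subsets only.\<close>

lemma eq_by_density:
  assumes U: "openin X U" and T: "Hausdorff_space T"
    and g: "continuous_map (subtopology Z {z \<in> topspace Z. q z \<in> U}) T g"
    and h: "continuous_map (subtopology Z {z \<in> topspace Z. q z \<in> U}) T h"
    and eq: "\<And>y. y \<in> topspace Y \<Longrightarrow> p y \<in> U \<Longrightarrow> g (emb y) = h (emb y)"
    and z: "z \<in> topspace Z" "q z \<in> U"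
  shows "g z = h z"
proof (rule forall_in_closure_of_eq[OF _ T g h])
  let ?V = "{z \<in> topspace Z. q z \<in> U}"
  let ?S = "emb ` {y \<in> topspace Y. p y \<in> U}"
  show "g x = h x" if "x \<in> ?S" for x using that eq by auto
  have V: "openin Z ?V" using open_over[OF U] .
  show "z \<in> subtopology Z ?V closure_of ?S"
    unfolding in_closure_of
  proof (intro conjI allI impI)
    show "z \<in> topspace (subtopology Z ?V)" using z by simp
    fix N assume "z \<in> N \<and> openin (subtopology Z ?V) N"
    then have N: "z \<in> N" "openin Z N" "N \<subseteq> ?V" using openin_open_subtopology[OF V] by blast+
    then obtain y where "y \<in> topspace Y" "emb y \<in> N" using emb_dense by blast
    then show "\<exists>y. y \<in> ?S \<and> y \<in> N" using q_emb N(3) by (intro exI[of _ "emb y"]) auto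
  qed
qed

text \<open>
  The limit of \<open>f\<close> at \<open>z\<close>: a point \<open>l\<close> that is not the limit has a bump \<open>k\<close> that vanishes at
  values of \<open>f\<close> taken arbitrarily close to \<open>z\<close>. The function \<open>(h \<circ> p) \<cdot> (k \<circ> f)\<close> belongs to
  \<open>A\<close>, so it converges at \<open>z\<close>, necessarily to 0, and therefore \<open>f\<close> leaves a neighbourhood of
  \<open>l\<close> near \<open>z\<close>. If this happened for all \<open>l\<close> in a compact set, \<open>f\<close> would leave that set.
\<close>

lemma limit_exists:
  assumes W: "locally_compact_Hausdorff W" and U: "openin X U"
    and f: "continuous_map (subtopology Y {y \<in> topspace Y. p y \<in> U}) W f"
    and comp: "\<And>K. compactin X K \<Longrightarrow> K \<subseteq> U \<Longrightarrow>
      \<exists>C. compactin W C \<and> (\<forall>y\<in>topspace Y. p y \<in> K \<longrightarrow> f y \<in> C)"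
    and z: "z \<in> topspace Z" "q z \<in> U"
  shows "\<exists>l\<in>topspace W. \<forall>V. openin W V \<and> l \<in> V \<longrightarrow>
    (\<exists>N. openin Z N \<and> z \<in> N \<and> (\<forall>y\<in>topspace Y. p y \<in> U \<and> emb y \<in> N \<longrightarrow> f y \<in> V))"
proof (rule ccontr)
  assume neg: "\<not> ?thesis"
  interpret W: locally_compact_Hausdorff W by fact
  let ?YU = "{y \<in> topspace Y. p y \<in> U}"
  have YU: "openin Y ?YU" by (rule openin_continuous_map_preimage[OF p_cont U])
  obtain h K where h: "h \<in> C0 X" "h (q z) = 1" "\<And>x. x \<notin> K \<Longrightarrow> h x = 0" "\<And>x. cmod (h x) \<le> 1"
    "compactin X K" "K \<subseteq> U"
    using C0_point_bump[OF z(2) U] by blast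
  obtain C where C: "compactin W C" "\<And>y. y \<in> topspace Y \<Longrightarrow> p y \<in> K \<Longrightarrow> f y \<in> C"
    using comp[OF h(5,6)] by blast
  have leave: "\<exists>V N. openin W V \<and> l \<in> V \<and> openin Z N \<and> z \<in> N \<and>
      (\<forall>y\<in>topspace Y. emb y \<in> N \<longrightarrow> p y \<in> K \<and> f y \<notin> V)" if l: "l \<in> C" for l
  proof -
    have "l \<in> topspace W" using l C compactin_subset_topspace by blast
    then obtain V0 where V0: "openin W V0" "l \<in> V0" "\<And>N. openin Z N \<Longrightarrow> z \<in> N \<Longrightarrow>
        \<exists>y\<in>topspace Y. p y \<in> U \<and> emb y \<in> N \<and> f y \<notin> V0"
    proof -
      from neg \<open>l \<in> topspace W\<close> obtain V where V: "openin W V" "l \<in> V" and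
        no: "\<not> (\<exists>N. openin Z N \<and> z \<in> N \<and> (\<forall>y\<in>topspace Y. p y \<in> U \<and> emb y \<in> N \<longrightarrow> f y \<in> V))"
        by meson
      show thesis by (rule that[OF V]) (use no in meson)
    qed
    obtain k where k: "continuous_map W euclideanreal k" "k l = 1"
      "\<And>w. w \<in> topspace W \<Longrightarrow> 0 \<le> k w \<and> k w \<le> 1" "\<And>w. w \<in> topspace W \<Longrightarrow> w \<notin> V0 \<Longrightarrow> k w = 0"
      using W.point_bump[OF V0(2,1)] by (metis subsetD)
    have fW: "f y \<in> topspace W" if "y \<in> ?YU" for y using f that by (auto simp: continuous_map_def)
    define F where "F y = (if y \<in> ?YU then complex_of_real (k (f y)) * h (p y) else 0)" for y
    have FA: "F \<in> A"
    proof (rule A_compact_base[where K = K and B = 1])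
      have XK: "openin X (topspace X - K)"
        using h(5) Hausdorff compactin_imp_closedin by blast
      have c1: "continuous_map (subtopology Y ?YU) euclidean (\<lambda>y. complex_of_real (k (f y)) * pullback h y)"
        using continuous_map_compose[OF f k(1)]
        by (intro continuous_map_mult continuous_map_of_real
            continuous_map_from_subtopology[OF A_cont[OF pullback_in[OF h(1)]]]) (simp add: o_def)
      show "continuous_map Y euclidean F"
      proof (rule continuous_map_locally)
        fix y assume y: "y \<in> topspace Y"
        show "\<exists>O' g. openin Y O' \<and> y \<in> O' \<and> continuous_map (subtopology Y O') euclidean g \<and> (\<forall>y\<in>O'. g y = F y)"
        proof (cases "p y \<in> U")
          case True
          then show ?thesis using c1 YU y
            by (intro exI[of _ ?YU] exI[of _ "\<lambda>y. complex_of_real (k (f y)) * pullback h y"])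
              (auto simp: F_def pullback_def)
        next
          case False
          then show ?thesis
            using y XK h(3,6) p_in openin_continuous_map_preimage[OF p_cont XK]
            by (intro exI[of _ "{y \<in> topspace Y. p y \<in> topspace X - K}"] exI[of _ "\<lambda>_. 0"])
              (auto simp: F_def)
        qed
      qed
      show "cmod (F y) \<le> 1" for y
        using k(3)[OF fW[of y]] h(4)[of "p y"] mult_mono[of "\<bar>k (f y)\<bar>" 1 "cmod (h (p y))" 1]
        by (auto simp: F_def norm_mult)
    qed (use h in \<open>auto simp: F_def\<close>)
    \<comment> \<open>On \<open>N\<close> the function \<open>F = k h\<close> is within 1/2 of its value 0 at \<open>y0\<close> and \<open>h > 3/4\<close>; hence
      \<open>k < 2/3\<close> there, while \<open>k l = 1\<close>.\<close>
    define N where "N = {\<psi> \<in> topspace Z. \<psi> F \<in> ball (z F) (1/4)} \<inter>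
      {\<psi> \<in> topspace Z. \<psi> (pullback h) \<in> ball 1 (1/4)}"
    have N: "openin Z N" unfolding N_def by (intro openin_Int eval_open FA pullback_in h(1)) auto
    have zN: "z \<in> N" using z h q_eval[OF z(1) h(1)] by (auto simp: N_def)
    obtain y0 where y0: "y0 \<in> topspace Y" "p y0 \<in> U" "emb y0 \<in> N" "f y0 \<notin> V0" using V0(3)[OF N zN] by blast
    have "F y0 = 0" using y0 k(4)[OF fW] by (auto simp: F_def)
    then have zF: "cmod (z F) < 1/4" using y0(3) FA by (auto simp: N_def emb_eval dist_norm)
    have "p y \<in> K \<and> k (f y) < 2/3" if y: "y \<in> topspace Y" "emb y \<in> N" for y
    proof -
      have a: "cmod (z F - F y) < 1/4" "cmod (1 - h (p y)) < 1/4"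
        using y FA pullback_in[OF h(1)] by (auto simp: N_def emb_eval dist_norm pullback_def)
      have b: "cmod (F y) < 1/2" using a(1) zF norm_triangle_sub[of "F y" "z F"] by (simp add: norm_minus_commute)
      have c: "cmod (h (p y)) > 3/4" using a(2) norm_triangle_sub[of 1 "h (p y)"] by simp
      have d: "p y \<in> K" using c h(3) by force
      then have yU: "y \<in> ?YU" using y h(6) by auto
      then have e: "cmod (F y) = k (f y) * cmod (h (p y))" "k (f y) \<ge> 0" using k(3)[OF fW] by (auto simp: F_def norm_mult)
      then have "k (f y) * (3/4) \<le> cmod (F y)" using c by (metis less_imp_le mult_left_mono)
      then show ?thesis using b d by simp
    qed
    then have "p y \<in> K \<and> f y \<notin> {w \<in> topspace W. k w \<in> {2/3<..}}" if "y \<in> topspace Y" "emb y \<in> N" for y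
      using that by fastforce
    moreover have "openin W {w \<in> topspace W. k w \<in> {2/3<..}}"
      by (rule openin_continuous_map_preimage[OF k(1)]) auto
    moreover have "l \<in> {w \<in> topspace W. k w \<in> {2/3<..}}"
      using k(2) \<open>l \<in> topspace W\<close> by simp
    ultimately show ?thesis using N zN by blast
  qed
  then obtain V N where VN: "\<And>l. l \<in> C \<Longrightarrow> openin W (V l) \<and> l \<in> V l \<and> openin Z (N l) \<and> z \<in> N l \<and>
      (\<forall>y\<in>topspace Y. emb y \<in> N l \<longrightarrow> p y \<in> K \<and> f y \<notin> V l)" by metis
  obtain D where D: "finite D" "D \<subseteq> C" "C \<subseteq> (\<Union>l\<in>D. V l)"
    using C(1) VN unfolding compactin_def by (smt (verit) UN_I finite_subset_image imageE subsetI)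
  \<comment> \<open>The first set keeps \<open>f y\<close> in \<open>C\<close>, also when \<open>C\<close> is empty.\<close>
  define M where "M = {\<psi> \<in> topspace Z. \<psi> (pullback h) \<in> - {0}} \<inter> \<Inter>((\<lambda>l. topspace Z \<inter> N l) ` D) "
  have Nl: "openin Z (topspace Z \<inter> N l)" if "l \<in> D" for l
    using VN D(2) that by (intro openin_Int) auto
  have "openin Z M"
  proof (cases "D = {}")
    case False
    then show ?thesis unfolding M_def using D(1) Nl
      by (intro openin_Int[OF eval_open[OF pullback_in[OF h(1)]]] openin_Inter) auto
  qed (use eval_open[OF pullback_in[OF h(1)], of "- {0}"] in \<open>auto simp: M_def\<close>)
  moreover have "z \<in> M" using z VN D q_eval[OF z(1) h(1)] h(2) by (auto simp: M_def)
  ultimately obtain y where y: "y \<in> topspace Y" "emb y \<in> M" using emb_dense by blast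
  then have "h (p y) \<noteq> 0" using pullback_in[OF h(1)] by (auto simp: M_def emb_eval pullback_def)
  then have "f y \<in> C" using y C h by blast
  then obtain l where l: "l \<in> D" "f y \<in> V l" using D by blast
  then have "emb y \<in> N l" using y(2) unfolding M_def by blast
  then show False using VN[of l] D(2) l y(1) by blast
qed

text \<open>The universal property of the fibrewise compactification, local over the base. The condition
  \<open>comp\<close> holds for instance for every map over \<open>U\<close> into a fibrewise compact space.\<close>

theorem extension:
  assumes W: "locally_compact_Hausdorff W" and U: "openin X U"
    and f: "continuous_map (subtopology Y {y \<in> topspace Y. p y \<in> U}) W f"
    and comp: "\<And>K. compactin X K \<Longrightarrow> K \<subseteq> U \<Longrightarrow>
      \<exists>C. compactin W C \<and> (\<forall>y\<in>topspace Y. p y \<in> K \<longrightarrow> f y \<in> C)"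
  obtains g where "continuous_map (subtopology Z {z \<in> topspace Z. q z \<in> U}) W g"
    "\<And>y. y \<in> topspace Y \<Longrightarrow> p y \<in> U \<Longrightarrow> g (emb y) = f y"
proof -
  interpret W: locally_compact_Hausdorff W by fact
  let ?YU = "{y \<in> topspace Y. p y \<in> U}"
  let ?T = "{z \<in> topspace Z. q z \<in> U}"
  let ?S = "emb ` ?YU"
  have YU: "openin Y ?YU" by (rule openin_continuous_map_preimage[OF p_cont U])
  define f' where "f' = f \<circ> inv_into (topspace Y) emb"
  have f': "f' (emb y) = f y" if "y \<in> topspace Y" for y
    using that emb_inj inv_into_f_f[of emb "topspace Y" y] by (auto simp: f'_def inj_on_def)
  have fW: "f y \<in> topspace W" if "y \<in> ?YU" for y using f that by (auto simp: continuous_map_def)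
  obtain g where g: "continuous_map (subtopology Z ?T) W g" "\<And>x. x \<in> ?S \<Longrightarrow> g x = f' x"
  proof (rule continuous_map_extension_pointwise_alt[of W ?S ?T Z f'])
    show "regular_space W"
      using W.locally_compact W.Hausdorff locally_compact_Hausdorff_imp_regular_space by blast
    show "?S \<subseteq> ?T" using emb_in q_emb by auto
    show "?T \<subseteq> Z closure_of ?S"
    proof
      fix z assume z: "z \<in> ?T"
      have "\<exists>y. y \<in> ?S \<and> y \<in> N" if N: "z \<in> N" "openin Z N" for N
      proof -
        obtain y where "y \<in> topspace Y" "emb y \<in> N \<inter> ?T"
          using emb_dense[OF openin_Int[OF N(2) open_over[OF U]]] z N by blast
        then show ?thesis using q_emb by auto
      qed
      then show "z \<in> Z closure_of ?S" using z by (auto simp: in_closure_of)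
    qed
    show "continuous_map (subtopology Z ?S) W f'"
      unfolding continuous_map_def
    proof (intro conjI allI impI)
      show "f' \<in> topspace (subtopology Z ?S) \<rightarrow> topspace W" using f' fW by auto
      fix V assume V: "openin W V"
      have fV: "openin Y {y \<in> topspace Y. p y \<in> U \<and> f y \<in> V}"
        using openin_continuous_map_preimage[OF f V] openin_trans_full[OF _ YU]
        by (auto elim!: back_subst[of "openin Y"])
      show "openin (subtopology Z ?S) {x \<in> topspace (subtopology Z ?S). f' x \<in> V}"
      proof (subst openin_subopen, clarsimp)
        fix y assume y: "y \<in> topspace Y" "p y \<in> U" "f' (emb y) \<in> V" "emb y \<in> topspace Z"
        then obtain N where N: "openin Z N" "emb y \<in> N"
          "\<And>y'. y' \<in> topspace Y \<Longrightarrow> emb y' \<in> N \<Longrightarrow> p y' \<in> U \<and> f y' \<in> V"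
          using emb_open_onto_image[OF fV, of y] f' by auto
        have "openin (subtopology Z ?S) (N \<inter> ?S)" using N(1) by (simp add: openin_subtopology_Int)
        moreover have "N \<inter> ?S \<subseteq> {x \<in> topspace Z. x \<in> ?S \<and> f' x \<in> V}" using N f' emb_in by auto
        ultimately show "\<exists>T. openin (subtopology Z ?S) T \<and> emb y \<in> T \<and>
            T \<subseteq> {x \<in> topspace Z. x \<in> ?S \<and> f' x \<in> V}"
          using N y by blast
      qed
    qed
    fix z assume z: "z \<in> ?T - ?S"
    then obtain l where l: "l \<in> topspace W" "\<And>V. openin W V \<Longrightarrow> l \<in> V \<Longrightarrow>
      \<exists>N. openin Z N \<and> z \<in> N \<and> (\<forall>y\<in>topspace Y. p y \<in> U \<and> emb y \<in> N \<longrightarrow> f y \<in> V)"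
      using limit_exists[OF W U f comp, of z] by auto
    have "limitin W f' l (atin_within Z z ?S)"
      unfolding limitin_def eventually_atin_within
    proof (intro conjI allI impI disjI2 l(1))
      fix V assume "openin W V \<and> l \<in> V"
      then obtain N where "openin Z N" "z \<in> N" "\<forall>y\<in>topspace Y. p y \<in> U \<and> emb y \<in> N \<longrightarrow> f y \<in> V"
        using l(2) by blast
      then show "\<exists>N. openin Z N \<and> z \<in> N \<and> (\<forall>x\<in>N. x \<in> ?S \<and> x \<noteq> z \<longrightarrow> f' x \<in> V)"
        using f' by auto
    qed
    then show "\<exists>l. limitin W f' l (atin_within Z z ?S)" by blast
  qed auto
  show thesis
    by (rule that[OF g(1)]) (use g(2) f' in auto)
qed

end

section \<open>Groupoids and their actions\<close>

lemma action_continuous: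
  assumes act: "continuous_map (subtopology (prod_topology (gtop G) Y)
      {(g, y). g \<in> arrows G \<and> y \<in> topspace Y \<and> src G g = p y}) Y (\<lambda>(g, y). a g y)"
    and c: "continuous_map M (gtop G) c" and d: "continuous_map M Y d"
    and src: "\<And>m. m \<in> topspace M \<Longrightarrow> src G (c m) = p (d m)"
  shows "continuous_map M Y (\<lambda>m. a (c m) (d m))"
proof -
  have "continuous_map M (subtopology (prod_topology (gtop G) Y)
      {(g, y). g \<in> arrows G \<and> y \<in> topspace Y \<and> src G g = p y}) (\<lambda>m. (c m, d m))"
    using c d src continuous_map_image_subset_topspace[OF c] continuous_map_image_subset_topspace[OF d]
    by (auto simp: continuous_map_in_subtopology continuous_map_pairedI arrows_def)
  from continuous_map_compose[OF this act] show ?thesis by (simp add: o_def)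
qed

locale lc_groupoid =
  fixes G :: "'g groupoid"
  assumes lc_groupoid: "locally_compact_groupoid G"
begin

lemma
  assumes "g \<in> arrows G"
  shows rng_arrow: "rng G g \<in> arrows G" and src_arrow: "src G g \<in> arrows G"
    and inv_arrow: "ginv G g \<in> arrows G"
    and rng_rng: "rng G (rng G g) = rng G g" and src_rng: "src G (rng G g) = rng G g"
    and rng_src: "rng G (src G g) = src G g"
    and rng_inv: "rng G (ginv G g) = src G g" and src_inv: "src G (ginv G g) = rng G g"
    and inv_mult: "gmult G (ginv G g) g = src G g"
    and rng_mult_id: "gmult G (rng G g) g = g" and mult_src_id: "gmult G g (src G g) = g"
  using assms lc_groupoid by (auto simp: locally_compact_groupoid_def is_groupoid_def)

lemma
  assumes "g \<in> arrows G" "h \<in> arrows G" "src G g = rng G h"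
  shows mult_arrow: "gmult G g h \<in> arrows G" and rng_mult: "rng G (gmult G g h) = rng G g"
    and src_mult: "src G (gmult G g h) = src G h"
  using assms lc_groupoid unfolding locally_compact_groupoid_def is_groupoid_def by blast+

lemma mult_assoc:
  assumes "g \<in> arrows G" "h \<in> arrows G" "k \<in> arrows G" "src G g = rng G h" "src G h = rng G k"
  shows "gmult G (gmult G g h) k = gmult G g (gmult G h k)"
  using assms lc_groupoid unfolding locally_compact_groupoid_def is_groupoid_def by blast

lemma inv_inv:
  assumes g: "g \<in> arrows G"
  shows "ginv G (ginv G g) = g"
proof -
  let ?h = "ginv G g"
  let ?k = "ginv G ?h"
  have arr: "?h \<in> arrows G" "?k \<in> arrows G" using g inv_arrow by auto
  have "?k = gmult G ?k (gmult G ?h g)"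
    using mult_src_id[OF arr(2)] src_inv[OF arr(1)] rng_inv[OF g] inv_mult[OF g] by metis
  also have "\<dots> = gmult G (gmult G ?k ?h) g"
    using mult_assoc[OF arr(2,1) g] src_inv arr(1) g by metis
  also have "\<dots> = g" using inv_mult[OF arr(1)] src_inv[OF g] rng_mult_id[OF g] by metis
  finally show ?thesis .
qed

lemma units_eq: "units G = {g \<in> topspace (gtop G). rng G g = g}"
  by (auto simp: units_def arrows_def[symmetric] rng_arrow rng_rng) (metis imageI)

lemma topspace_units: "topspace (unit_space G) = units G"
  by (auto simp: unit_space_def units_eq)

lemma unit_arrow: "x \<in> units G \<Longrightarrow> x \<in> arrows G"
  by (simp add: units_eq arrows_def)

lemma rng_unit: "x \<in> units G \<Longrightarrow> rng G x = x"
  by (simp add: units_eq)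

lemma src_unit: "x \<in> units G \<Longrightarrow> src G x = x"
  by (metis rng_unit src_rng unit_arrow)

lemma rng_in_units: "g \<in> arrows G \<Longrightarrow> rng G g \<in> units G"
  by (simp add: units_def)

lemma src_in_units: "g \<in> arrows G \<Longrightarrow> src G g \<in> units G"
  by (metis rng_in_units rng_src src_arrow)

lemma G_locally_compact_Hausdorff: "locally_compact_Hausdorff (gtop G)"
  using lc_groupoid by unfold_locales (auto simp: locally_compact_groupoid_def)

lemma
  shows rng_cont: "continuous_map (gtop G) (unit_space G) (rng G)"
    and src_cont: "continuous_map (gtop G) (unit_space G) (src G)"
    and inv_cont: "continuous_map (gtop G) (gtop G) (ginv G)"
  using lc_groupoid rng_in_units src_in_units
  by (auto simp: locally_compact_groupoid_def unit_space_def continuous_map_in_subtopology arrows_def)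

lemma unit_space_locally_compact_Hausdorff: "locally_compact_Hausdorff (unit_space G)"
proof -
  interpret G: locally_compact_Hausdorff "gtop G" by (rule G_locally_compact_Hausdorff)
  have "closedin (gtop G) (units G)"
    unfolding units_eq using closedin_continuous_maps_eq[OF G.Hausdorff, of "gtop G" "rng G" "\<lambda>g. g"]
      continuous_map_into_fulltopology[OF rng_cont[unfolded unit_space_def]] by simp
  then show ?thesis
    unfolding unit_space_def using G.locally_compact G.Hausdorff
    by unfold_locales (auto intro: locally_compact_space_closed_subset Hausdorff_space_subtopology)
qed

lemma unit_space_into_G: "continuous_map M (unit_space G) c \<Longrightarrow> continuous_map M (gtop G) c"
  unfolding unit_space_def by (rule continuous_map_into_fulltopology)

lemma mult_continuous:
  assumes "continuous_map M (gtop G) c" "continuous_map M (gtop G) d"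
    "\<And>m. m \<in> topspace M \<Longrightarrow> src G (c m) = rng G (d m)"
  shows "continuous_map M (gtop G) (\<lambda>m. gmult G (c m) (d m))"
  by (rule action_continuous[where p = "rng G"])
    (use assms lc_groupoid in \<open>auto simp: locally_compact_groupoid_def arrows_def[symmetric]\<close>)

lemma left_mult_gspace: "is_gspace G (gtop G) (rng G) (gmult G)"
  unfolding is_gspace_def is_fibre_space_def
proof (intro conjI ballI impI)
  show "rng G ` topspace (gtop G) = topspace (unit_space G)"
    by (simp add: topspace_units units_def arrows_def)
  show "continuous_map (subtopology (prod_topology (gtop G) (gtop G))
      {(g, y). g \<in> arrows G \<and> y \<in> topspace (gtop G) \<and> src G g = rng G y}) (gtop G) (\<lambda>(g, y). gmult G g y)"
    using lc_groupoid by (simp add: locally_compact_groupoid_def arrows_def[symmetric])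
qed (use lc_groupoid rng_cont in \<open>auto simp: locally_compact_groupoid_def arrows_def[symmetric]
  rng_mult rng_mult_id mult_assoc\<close>)

end

locale gspace = lc_groupoid G for G :: "'g groupoid" +
  fixes Y :: "'y topology" and p :: "'y \<Rightarrow> 'g" and a :: "'g \<Rightarrow> 'y \<Rightarrow> 'y"
  assumes gspace: "is_gspace G Y p a"
begin

lemma fibre_space: "lc_fibre_space (unit_space G) Y p"
proof -
  interpret locally_compact_Hausdorff "unit_space G" by (rule unit_space_locally_compact_Hausdorff)
  show ?thesis using gspace by unfold_locales (simp add: is_gspace_def)
qed

lemma proj_cont: "continuous_map Y (unit_space G) p"
  using gspace by (simp add: is_gspace_def is_fibre_space_def)

lemma proj_unit: "y \<in> topspace Y \<Longrightarrow> p y \<in> units G"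
  using proj_cont topspace_units by (auto simp: continuous_map_def)

lemmas act_continuous = action_continuous[OF conjunct1[OF conjunct2[OF gspace[unfolded is_gspace_def]]]]

lemma
  assumes "g \<in> arrows G" "y \<in> topspace Y" "src G g = p y"
  shows act_in: "a g y \<in> topspace Y" and proj_act: "p (a g y) = rng G g"
proof -
  show "p (a g y) = rng G g" using gspace assms by (simp add: is_gspace_def)
  have "continuous_map (subtopology (prod_topology (gtop G) Y)
      {(g, y). g \<in> arrows G \<and> y \<in> topspace Y \<and> src G g = p y}) Y (\<lambda>(g, y). a g y)"
    using gspace by (simp add: is_gspace_def)
  from continuous_map_image_subset_topspace[OF this] show "a g y \<in> topspace Y"
    using assms by (force simp: arrows_def)
qed

lemma act_unit: "y \<in> topspace Y \<Longrightarrow> a (p y) y = y"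
  using gspace by (simp add: is_gspace_def)

lemma act_act:
  assumes "h \<in> arrows G" "g \<in> arrows G" "y \<in> topspace Y" "src G h = rng G g" "src G g = p y"
  shows "a (gmult G h g) y = a h (a g y)"
  using gspace assms by (simp add: is_gspace_def)

end

section \<open>Local sections of the source map\<close>

context lc_groupoid
begin

text \<open>\<open>S\<close> is an open set of arrows on which the source map is inverted by \<open>\<tau>\<close>. In contrast to a
  bisection, nothing is required of the range map.\<close>

definition source_section :: "'g set \<Rightarrow> ('g \<Rightarrow> 'g) \<Rightarrow> 'g set \<Rightarrow> bool" where
  "source_section V \<tau> S \<longleftrightarrow> openin (unit_space G) V \<and> openin (gtop G) S \<and>
     continuous_map (subtopology (unit_space G) V) (gtop G) \<tau> \<and>
     (\<forall>x\<in>V. src G (\<tau> x) = x) \<and> (\<forall>g\<in>S. src G g \<in> V \<and> \<tau> (src G g) = g)"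

lemma source_section_arrow: "source_section V \<tau> S \<Longrightarrow> x \<in> V \<Longrightarrow> \<tau> x \<in> arrows G"
  using openin_subset[of "unit_space G" V]
  by (auto simp: source_section_def continuous_map_def arrows_def)

lemma source_section_cont:
  assumes "source_section V \<tau> S" "continuous_map M (unit_space G) c" "\<And>m. m \<in> topspace M \<Longrightarrow> c m \<in> V"
  shows "continuous_map M (gtop G) (\<lambda>m. \<tau> (c m))"
proof -
  have "continuous_map M (subtopology (unit_space G) V) c"
    using assms(2,3) by (auto simp: continuous_map_in_subtopology)
  moreover have "continuous_map (subtopology (unit_space G) V) (gtop G) \<tau>"
    using assms(1) by (simp add: source_section_def)
  ultimately show ?thesis using continuous_map_compose by (fastforce simp: o_def)
qed

end

locale etale = lc_groupoid G for G :: "'g groupoid" +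
  assumes etale: "local_homeomorphism (gtop G) (unit_space G) (rng G)"
begin

lemma source_section_exists:
  assumes g: "g \<in> arrows G"
  obtains V \<tau> S where "source_section V \<tau> S" "g \<in> S"
proof -
  have "ginv G g \<in> topspace (gtop G)" using inv_arrow[OF g] by (simp add: arrows_def)
  then obtain U where U: "openin (gtop G) U" "ginv G g \<in> U" "openin (unit_space G) (rng G ` U)"
    "homeomorphic_map (subtopology (gtop G) U) (subtopology (unit_space G) (rng G ` U)) (rng G)"
    using etale unfolding local_homeomorphism_def by blast
  obtain \<rho> where \<rho>: "homeomorphic_maps (subtopology (gtop G) U) (subtopology (unit_space G) (rng G ` U)) (rng G) \<rho>"
    using U(4) homeomorphic_map_maps by blast
  have UG: "U \<subseteq> arrows G" using U(1) openin_subset arrows_def by metis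
  have \<rho>c: "continuous_map (subtopology (unit_space G) (rng G ` U)) (subtopology (gtop G) U) \<rho>"
    and \<rho>1: "\<And>u. u \<in> U \<Longrightarrow> \<rho> (rng G u) = u" 
    and \<rho>2: "\<And>x. x \<in> rng G ` U \<Longrightarrow> rng G (\<rho> x) = x"
    using \<rho> UG openin_subset[OF U(3)] by (auto simp: homeomorphic_maps_def arrows_def)
  have \<rho>U: "\<rho> x \<in> U" if "x \<in> rng G ` U" for x using that \<rho>1 by auto
  let ?S = "{g \<in> topspace (gtop G). ginv G g \<in> U}"
  have "source_section (rng G ` U) (ginv G \<circ> \<rho>) ?S"
    unfolding source_section_def
  proof (intro conjI ballI U(3))
    show "openin (gtop G) ?S" by (rule openin_continuous_map_preimage[OF inv_cont U(1)])
    show "continuous_map (subtopology (unit_space G) (rng G ` U)) (gtop G) (ginv G \<circ> \<rho>)"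
      using \<rho>c inv_cont by (auto intro: continuous_map_compose continuous_map_into_fulltopology)
    show "src G ((ginv G \<circ> \<rho>) x) = x" if "x \<in> rng G ` U" for x
      using \<rho>U[OF that] \<rho>2[OF that] UG src_inv by auto
    fix h assume "h \<in> ?S"
    then have h: "h \<in> arrows G" "ginv G h \<in> U" by (auto simp: arrows_def)
    show "src G h \<in> rng G ` U" using rng_inv[OF h(1)] h(2) by (metis imageI)
    show "(ginv G \<circ> \<rho>) (src G h) = h" using \<rho>1[OF h(2)] rng_inv[OF h(1)] inv_inv[OF h(1)] by simp
  qed
  then show thesis using that g U(2) by (auto simp: arrows_def)
qed

end

section \<open>The action on the fibrewise compactification\<close>

locale etale_gspace = etale G + gspace G Y p a
  for G :: "'g groupoid" and Y :: "'y topology" and p :: "'y \<Rightarrow> 'g" and a :: "'g \<Rightarrow> 'y \<Rightarrow> 'y"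
begin

sublocale lc_fibre_space "unit_space G" Y p by (rule fibre_space)

abbreviation over where "over V \<equiv> {z \<in> topspace Z. q z \<in> V}"

lemma q_cont_over: "continuous_map (subtopology Z (over V)) (unit_space G) q"
  by (intro continuous_map_from_subtopology q_cont)

lemma id_cont_over: "continuous_map (subtopology Z (over V)) Z (\<lambda>z. z)"
  by (intro continuous_map_from_subtopology) simp

text \<open>An equivariance that holds on \<open>Y\<close> persists in the limit. The arrow has to move along with the
  point of \<open>Z\<close>, which is what local sections are for.\<close>

lemma equivariant_by_density:
  assumes b: "is_gspace G Z q b" "\<And>g y. g \<in> arrows G \<Longrightarrow> y \<in> topspace Y \<Longrightarrow> src G g = p y \<Longrightarrow> b g (emb y) = emb (a g y)"
    and W: "is_gspace G W r c"
    and \<phi>: "continuous_map Z W \<phi>" "\<And>z. z \<in> topspace Z \<Longrightarrow> r (\<phi> z) = q z"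
    and eq: "\<And>g y. g \<in> arrows G \<Longrightarrow> y \<in> topspace Y \<Longrightarrow> src G g = p y \<Longrightarrow> \<phi> (emb (a g y)) = c g (\<phi> (emb y))"
    and gz: "g \<in> arrows G" "z \<in> topspace Z" "src G g = q z"
  shows "\<phi> (b g z) = c g (\<phi> z)"
proof -
  interpret B: gspace G Z q b using b by unfold_locales
  interpret C: gspace G W r c using W by unfold_locales
  obtain V \<tau> S where \<tau>: "source_section V \<tau> S" "g \<in> S" using source_section_exists[OF gz(1)] .
  have V: "openin (unit_space G) V" "\<And>x. x \<in> V \<Longrightarrow> src G (\<tau> x) = x" and g: "q z \<in> V" "\<tau> (q z) = g"
    using \<tau> gz(3) by (auto simp: source_section_def)
  have \<tau>q: "continuous_map (subtopology Z (over V)) (gtop G) (\<lambda>z. \<tau> (q z))"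
    by (rule source_section_cont[OF \<tau>(1) q_cont_over]) auto
  have \<phi>V: "continuous_map (subtopology Z (over V)) W \<phi>"
    by (intro continuous_map_from_subtopology \<phi>)
  have "\<phi> (b (\<tau> (q z)) z) = c (\<tau> (q z)) (\<phi> z)"
  proof (rule eq_by_density[OF V(1), where z = z and g = "\<lambda>z. \<phi> (b (\<tau> (q z)) z)" and h = "\<lambda>z. c (\<tau> (q z)) (\<phi> z)"])
    show "Hausdorff_space W" using W by (simp add: is_gspace_def is_fibre_space_def)
    have "continuous_map (subtopology Z (over V)) Z (\<lambda>z. b (\<tau> (q z)) z)"
      by (rule B.act_continuous[OF \<tau>q id_cont_over]) (use V in auto)
    from continuous_map_compose[OF this \<phi>(1)]
    show "continuous_map (subtopology Z (over V)) W (\<lambda>z. \<phi> (b (\<tau> (q z)) z))" by (simp add: o_def)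
    show "continuous_map (subtopology Z (over V)) W (\<lambda>z. c (\<tau> (q z)) (\<phi> z))"
      by (rule C.act_continuous[OF \<tau>q \<phi>V]) (use V \<phi>(2) in auto)
    fix y assume y: "y \<in> topspace Y" "p y \<in> V"
    then show "\<phi> (b (\<tau> (q (emb y))) (emb y)) = c (\<tau> (q (emb y))) (\<phi> (emb y))"
      using b(2) eq source_section_arrow[OF \<tau>(1)] V(2) q_emb by simp
  qed (use gz g in auto)
  then show ?thesis using g by simp
qed

definition extends_section where
  "extends_section V \<tau> E \<longleftrightarrow> continuous_map (subtopology Z (over V)) Z E \<and>
     (\<forall>y\<in>topspace Y. p y \<in> V \<longrightarrow> E (emb y) = emb (a (\<tau> (p y)) y))"

text \<open>Translation along \<open>\<tau>\<close> moves the points over a compact \<open>K \<subseteq> V\<close> to points over the compact set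
  \<open>r (\<tau> K)\<close>, above which \<open>Z\<close> is compact.\<close>

lemma extends_section_exists:
  assumes \<tau>: "source_section V \<tau> S"
  obtains E where "extends_section V \<tau> E"
proof -
  have V: "openin (unit_space G) V" "\<And>x. x \<in> V \<Longrightarrow> src G (\<tau> x) = x"
    and \<tau>c: "continuous_map (subtopology (unit_space G) V) (gtop G) \<tau>"
    using \<tau> by (auto simp: source_section_def)
  let ?YV = "{y \<in> topspace Y. p y \<in> V}"
  have "continuous_map (subtopology Y ?YV) Y (\<lambda>y. a (\<tau> (p y)) y)"
    by (intro act_continuous source_section_cont[OF \<tau>] continuous_map_from_subtopology[OF proj_cont])
      (use V(2) in \<open>auto intro: continuous_map_from_subtopology\<close>)
  from continuous_map_compose[OF this emb_cont]
  have f: "continuous_map (subtopology Y ?YV) Z (\<lambda>y. emb (a (\<tau> (p y)) y))" by (simp add: o_def)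
  have comp: "\<exists>C. compactin Z C \<and> (\<forall>y\<in>topspace Y. p y \<in> K \<longrightarrow> emb (a (\<tau> (p y)) y) \<in> C)"
    if K: "compactin (unit_space G) K" "K \<subseteq> V" for K
  proof (intro exI conjI ballI impI)
    have "compactin (subtopology (unit_space G) V) K" using K by (simp add: compactin_subtopology)
    then have "compactin (unit_space G) (rng G ` \<tau> ` K)"
      using image_compactin[OF _ \<tau>c] image_compactin[OF _ rng_cont] by blast
    then show "compactin Z {z \<in> topspace Z. q z \<in> rng G ` \<tau> ` K}" by (rule q_proper)
    fix y assume y: "y \<in> topspace Y" "p y \<in> K"
    then have "\<tau> (p y) \<in> arrows G" "src G (\<tau> (p y)) = p y"
      using K V(2) source_section_arrow[OF \<tau>] by auto
    then show "emb (a (\<tau> (p y)) y) \<in> {z \<in> topspace Z. q z \<in> rng G ` \<tau> ` K}"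
      using y act_in proj_act emb_in q_emb by auto
  qed
  show thesis
    by (rule extension[OF Z_locally_compact_Hausdorff V(1) f comp]) (auto intro!: that simp: extends_section_def)
qed

text \<open>Two local sections through the same arrow agree near its source, because \<open>S'\<close> is open. Hence the
  value of the extension at \<open>z\<close> depends on the arrow only.\<close>

lemma extends_section_local:
  assumes \<tau>: "source_section V \<tau> S" "source_section V' \<tau>' S'" and g: "g \<in> S" "g \<in> S'"
    and E: "extends_section V \<tau> E" "extends_section V' \<tau>' E'"
    and z: "z \<in> topspace Z" "q z = src G g"
  shows "E z = E' z"
proof -
  have V: "openin (unit_space G) V" "openin (unit_space G) V'" and S': "openin (gtop G) S'"
    and \<tau>c: "continuous_map (subtopology (unit_space G) V) (gtop G) \<tau>"
    using \<tau> by (auto simp: source_section_def)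
  let ?U = "{x \<in> topspace (subtopology (unit_space G) V). \<tau> x \<in> S'} \<inter> V'"
  have U: "openin (unit_space G) ?U"
    using openin_continuous_map_preimage[OF \<tau>c S'] openin_trans_full V by blast
  have eq: "\<tau> x = \<tau>' x" if "x \<in> ?U" for x
    using that \<tau> by (auto simp: source_section_def)
  have zU: "q z \<in> ?U" using \<tau> g z openin_subset[OF V(1)] by (auto simp: source_section_def)
  have sub: "continuous_map (subtopology Z (over ?U)) Z F" if "continuous_map (subtopology Z (over N)) Z F" "?U \<subseteq> N" for F N
    using that by (auto elim!: continuous_map_from_subtopology_mono)
  show ?thesis
  proof (rule eq_by_density[OF U Z_Hausdorff _ _ _ z(1) zU])
    show "continuous_map (subtopology Z (over ?U)) Z E" 
      by (rule sub[of V]) (use E in \<open>auto simp: extends_section_def\<close>)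
    show "continuous_map (subtopology Z (over ?U)) Z E'"
      by (rule sub[of V']) (use E in \<open>auto simp: extends_section_def\<close>)
    fix y assume y: "y \<in> topspace Y" "p y \<in> ?U"
    then show "E (emb y) = E' (emb y)" using E eq[OF y(2)] by (simp add: extends_section_def)
  qed
qed

text \<open>
  The arrow \<open>g\<close> acts on \<open>z\<close> by any extended translation along a local section through \<open>g\<close>. Joint
  continuity comes for free: for \<open>g\<close> in \<open>S\<close> the arrow is determined by its source \<open>q z\<close>, so near a
  given pair the action is a single continuous function of \<open>z\<close>.
\<close>

lemma beta_action_exists:
  obtains b where "\<And>g z. \<not> (g \<in> arrows G \<and> z \<in> topspace Z \<and> src G g = q z) \<Longrightarrow> b g z = undefined"
    "is_gspace G Z q b"
    "\<And>g y. g \<in> arrows G \<Longrightarrow> y \<in> topspace Y \<Longrightarrow> src G g = p y \<Longrightarrow> b g (emb y) = emb (a g y)"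
proof -
  have "\<forall>g\<in>arrows G. \<exists>V \<tau> S E. source_section V \<tau> S \<and> g \<in> S \<and> extends_section V \<tau> E"
    using source_section_exists extends_section_exists by metis
  then obtain E where E: "\<And>g. g \<in> arrows G \<Longrightarrow> \<exists>V \<tau> S. source_section V \<tau> S \<and> g \<in> S \<and> extends_section V \<tau> (E g)"
    by metis
  define b where "b g z = (if g \<in> arrows G \<and> z \<in> topspace Z \<and> src G g = q z then E g z else undefined)" for g z
  have b_eq: "b g z = F z" if "source_section V \<tau> S" "g \<in> S" "extends_section V \<tau> F" "z \<in> topspace Z" "src G g = q z"
    for g z V \<tau> S F
  proof -
    have "g \<in> arrows G" using that(1,2) openin_subset by (auto simp: source_section_def arrows_def)
    moreover from E[OF this] obtain V' \<tau>' S' where "source_section V' \<tau>' S'" "g \<in> S'" "extends_section V' \<tau>' (E g)"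
      by blast
    ultimately show ?thesis
      using extends_section_local[OF that(1) _ that(2) _ that(3)] that(4,5) by (simp add: b_def)
  qed
  have b_emb: "b g (emb y) = emb (a g y)" if y: "g \<in> arrows G" "y \<in> topspace Y" "src G g = p y" for g y
  proof -
    obtain V \<tau> S F where F: "source_section V \<tau> S" "g \<in> S" "extends_section V \<tau> F"
      using source_section_exists[OF y(1)] extends_section_exists by metis
    then have "b g (emb y) = F (emb y)" using b_eq emb_in q_emb y by simp
    then show ?thesis using F y by (auto simp: extends_section_def source_section_def)
  qed
  let ?D = "{(g, z). g \<in> arrows G \<and> z \<in> topspace Z \<and> src G g = q z}"
  let ?M = "subtopology (prod_topology (gtop G) Z) ?D"
  have M: "topspace ?M = ?D" by (auto simp: arrows_def)
  have cont: "continuous_map ?M Z (\<lambda>(g, z). b g z)"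
  proof (rule continuous_map_locally)
    fix m assume "m \<in> topspace ?M"
    then obtain g z where m: "m = (g, z)" "g \<in> arrows G" "z \<in> topspace Z" "src G g = q z" using M by auto
    obtain V \<tau> S F where F: "source_section V \<tau> S" "g \<in> S" "extends_section V \<tau> F"
      using source_section_exists[OF m(2)] extends_section_exists by metis
    let ?O = "(S \<times> topspace Z) \<inter> ?D"
    have "openin (prod_topology (gtop G) Z) (S \<times> topspace Z)"
      using F(1) by (auto simp: source_section_def openin_prod_Times_iff)
    then have "openin ?M ?O" by (rule openin_subtopology_Int)
    moreover have "continuous_map (subtopology ?M ?O) Z (F \<circ> snd)"
    proof (rule continuous_map_compose[where X' = "subtopology Z (over V)"])
      show "continuous_map (subtopology ?M ?O) (subtopology Z (over V)) snd"
        using F(1) unfolding continuous_map_in_subtopology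
        by (auto simp: source_section_def intro!: continuous_map_from_subtopology continuous_map_snd)
      show "continuous_map (subtopology Z (over V)) Z F" using F(3) by (simp add: extends_section_def)
    qed
    moreover have "\<forall>m\<in>?O. (F \<circ> snd) m = (\<lambda>(g, z). b g z) m" using b_eq[OF F(1) _ F(3)] by auto
    ultimately show "\<exists>O' f. openin ?M O' \<and> m \<in> O' \<and> continuous_map (subtopology ?M O') Z f \<and>
        (\<forall>m\<in>O'. f m = (\<lambda>(g, z). b g z) m)"
      using m F(2) by (intro exI[of _ ?O] exI[of _ "F \<circ> snd"]) auto
  qed
  note b_cont = action_continuous[OF cont]
  have proj: "q (b g z) = rng G g" if g: "g \<in> arrows G" "z \<in> topspace Z" "src G g = q z" for g z
  proof -
    obtain V \<tau> S where \<tau>: "source_section V \<tau> S" "g \<in> S" using source_section_exists[OF g(1)] .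
    then have V: "openin (unit_space G) V" "\<And>x. x \<in> V \<Longrightarrow> src G (\<tau> x) = x" "q z \<in> V" "\<tau> (q z) = g"
      using g(3) by (auto simp: source_section_def)
    have \<tau>q: "continuous_map (subtopology Z (over V)) (gtop G) (\<lambda>z. \<tau> (q z))"
      by (rule source_section_cont[OF \<tau>(1) q_cont_over]) auto
    have "q (b (\<tau> (q z)) z) = rng G (\<tau> (q z))"
    proof (rule eq_by_density[OF V(1), where z = z and g = "\<lambda>z. q (b (\<tau> (q z)) z)" and h = "\<lambda>z. rng G (\<tau> (q z))"])
      show "Hausdorff_space (unit_space G)" by (rule Hausdorff)
      have "continuous_map (subtopology Z (over V)) Z (\<lambda>z. b (\<tau> (q z)) z)"
        by (rule b_cont[OF \<tau>q id_cont_over]) (use V in auto)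
      from continuous_map_compose[OF this q_cont]
      show "continuous_map (subtopology Z (over V)) (unit_space G) (\<lambda>z. q (b (\<tau> (q z)) z))" by (simp add: o_def)
      from continuous_map_compose[OF \<tau>q rng_cont]
      show "continuous_map (subtopology Z (over V)) (unit_space G) (\<lambda>z. rng G (\<tau> (q z)))" by (simp add: o_def)
      fix y assume y: "y \<in> topspace Y" "p y \<in> V"
      then show "q (b (\<tau> (q (emb y))) (emb y)) = rng G (\<tau> (q (emb y)))"
        using b_emb q_emb V(2) source_section_arrow[OF \<tau>(1)] act_in proj_act by simp
    qed (use g V in auto)
    then show ?thesis using V(4) by simp
  qed
  have unit: "b (q z) z = z" if z: "z \<in> topspace Z" for z
  proof -
    let ?U = "topspace (unit_space G)"
    have q_units: "q z \<in> units G" if "z \<in> topspace Z" for z using q_in[OF that] topspace_units by simp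
    show ?thesis
    proof (rule eq_by_density[OF openin_topspace Z_Hausdorff _ id_cont_over _ z q_in[OF z], where g = "\<lambda>z. b (q z) z"])
      show "continuous_map (subtopology Z (over ?U)) Z (\<lambda>z. b (q z) z)"
        by (rule b_cont[OF unit_space_into_G[OF q_cont_over] id_cont_over]) (use q_units src_unit in auto)
      fix y assume "y \<in> topspace Y" "p y \<in> ?U"
      then show "b (q (emb y)) (emb y) = emb y"
        using b_emb[of "p y" y] q_emb proj_unit unit_arrow src_unit act_unit by simp
    qed
  qed
  \<comment> \<open>Both arrows move along with \<open>z\<close>: the first along \<open>\<tau>1\<close>, and the second along \<open>\<tau>2\<close>, starting where
    the first one ends.\<close>
  have assoc: "b (gmult G g2 g1) z = b g2 (b g1 z)"
    if g: "g2 \<in> arrows G" "g1 \<in> arrows G" "z \<in> topspace Z" "src G g2 = rng G g1" "src G g1 = q z" for g2 g1 z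
  proof -
    obtain V1 \<tau>1 S1 where \<tau>1: "source_section V1 \<tau>1 S1" "g1 \<in> S1" using source_section_exists[OF g(2)] .
    obtain V2 \<tau>2 S2 where \<tau>2: "source_section V2 \<tau>2 S2" "g2 \<in> S2" using source_section_exists[OF g(1)] .
    have V1: "openin (unit_space G) V1" "\<And>x. x \<in> V1 \<Longrightarrow> src G (\<tau>1 x) = x" "q z \<in> V1" "\<tau>1 (q z) = g1"
      and \<tau>1c: "continuous_map (subtopology (unit_space G) V1) (gtop G) \<tau>1"
      using g \<tau>1 by (auto simp: source_section_def)
    have V2: "openin (unit_space G) V2" "\<And>x. x \<in> V2 \<Longrightarrow> src G (\<tau>2 x) = x" "rng G g1 \<in> V2" "\<tau>2 (rng G g1) = g2"
      using g \<tau>2 by (auto simp: source_section_def)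
    let ?U = "{x \<in> topspace (subtopology (unit_space G) V1). rng G (\<tau>1 x) \<in> V2}"
    let ?t1 = "\<lambda>z. \<tau>1 (q z)"
    let ?t2 = "\<lambda>z. \<tau>2 (rng G (\<tau>1 (q z)))"
    have "continuous_map (subtopology (unit_space G) V1) (unit_space G) (\<lambda>x. rng G (\<tau>1 x))"
      using continuous_map_compose[OF \<tau>1c rng_cont] by (simp add: o_def)
    then have U: "openin (unit_space G) ?U"
      using openin_continuous_map_preimage V2(1) openin_trans_full V1(1) by blast
    have t1: "continuous_map (subtopology Z (over ?U)) (gtop G) ?t1"
      by (rule source_section_cont[OF \<tau>1(1) q_cont_over]) auto
    then have "continuous_map (subtopology Z (over ?U)) (unit_space G) (\<lambda>z. rng G (?t1 z))"
      using continuous_map_compose[OF t1 rng_cont] by (simp add: o_def)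
    then have t2: "continuous_map (subtopology Z (over ?U)) (gtop G) ?t2"
      by (rule source_section_cont[OF \<tau>2(1)]) auto
    have "b (gmult G (?t2 z) (?t1 z)) z = b (?t2 z) (b (?t1 z) z)"
    proof (rule eq_by_density[OF U Z_Hausdorff, where z = z and g = "\<lambda>z. b (gmult G (?t2 z) (?t1 z)) z"
          and h = "\<lambda>z. b (?t2 z) (b (?t1 z) z)"])
      show "continuous_map (subtopology Z (over ?U)) Z (\<lambda>z. b (gmult G (?t2 z) (?t1 z)) z)"
        by (rule b_cont[OF mult_continuous[OF t2 t1] id_cont_over])
          (use V1 V2 source_section_arrow[OF \<tau>1(1)] source_section_arrow[OF \<tau>2(1)] src_mult in auto)
      have "continuous_map (subtopology Z (over ?U)) Z (\<lambda>z. b (?t1 z) z)"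
        by (rule b_cont[OF t1 id_cont_over]) (use V1 in auto)
      then show "continuous_map (subtopology Z (over ?U)) Z (\<lambda>z. b (?t2 z) (b (?t1 z) z))"
        by (rule b_cont[OF t2]) (use V1 V2 source_section_arrow[OF \<tau>1(1)] proj in auto)
      fix y assume y: "y \<in> topspace Y" "p y \<in> ?U"
      have "\<tau>1 (p y) \<in> arrows G" "\<tau>2 (rng G (\<tau>1 (p y))) \<in> arrows G"
        "src G (\<tau>1 (p y)) = p y" "src G (\<tau>2 (rng G (\<tau>1 (p y)))) = rng G (\<tau>1 (p y))"
        using y V1 V2 source_section_arrow[OF \<tau>1(1)] source_section_arrow[OF \<tau>2(1)] by auto
      then show "b (gmult G (?t2 (emb y)) (?t1 (emb y))) (emb y) = b (?t2 (emb y)) (b (?t1 (emb y)) (emb y))"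
        using y b_emb mult_arrow src_mult act_in proj_act act_act q_emb by simp
    qed (use g V1 V2 q_in in auto)
    then show ?thesis using V1 V2 by simp
  qed
  show thesis
  proof (rule that)
    show "is_gspace G Z q b"
      using beta_fibrewise_compact cont proj unit assoc
      by (auto simp: is_gspace_def fibrewise_compact_def)
  qed (use b_emb in \<open>auto simp: b_def\<close>)
qed

abbreviation beta_act where "beta_act \<equiv> beta_action G Y p a"

lemma
  shows beta_gspace: "is_gspace G Z q beta_act"
    and beta_action_emb: "\<And>g y. g \<in> arrows G \<Longrightarrow> y \<in> topspace Y \<Longrightarrow> src G g = p y \<Longrightarrow> beta_act g (emb y) = emb (a g y)"
proof -
  let ?P = "\<lambda>b. (\<forall>g z. \<not> (g \<in> arrows G \<and> z \<in> topspace Z \<and> src G g = q z) \<longrightarrow> b g z = undefined) \<and>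
     is_gspace G Z q b \<and>
     (\<forall>g\<in>arrows G. \<forall>y\<in>topspace Y. src G g = p y \<longrightarrow> b g (emb y) = emb (a g y))"
  obtain b0 where b0: "?P b0" by (rule beta_action_exists) blast
  have uniq: "b' g z = b0 g z" if b': "?P b'" and gz: "g \<in> arrows G" "z \<in> topspace Z" "src G g = q z" for b' g z
  proof -
    have gs: "is_gspace G Z q b'" "is_gspace G Z q b0" using b' b0 by blast+
    have emb: "b' h (emb y) = emb (a h y)" "b0 h (emb y) = emb (a h y)"
      if "h \<in> arrows G" "y \<in> topspace Y" "src G h = p y" for h y
      using that b' b0 by blast+
    have "(\<lambda>z. z) (b' g z) = b0 g ((\<lambda>z. z) z)"
    proof (rule equivariant_by_density[OF gs(1) emb(1) gs(2) _ _ _ gz])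
      show "emb (a h y) = b0 h (emb y)" if "h \<in> arrows G" "y \<in> topspace Y" "src G h = p y" for h y
        using emb(2)[OF that] by simp
    qed simp_all
    then show ?thesis .
  qed
  have "b' = b0" if b': "?P b'" for b'
  proof (rule ext, rule ext)
    fix g z
    show "b' g z = b0 g z"
      using uniq[OF b', of g z] b0 b' by (cases "g \<in> arrows G \<and> z \<in> topspace Z \<and> src G g = q z") auto
  qed
  then have "?P (THE b. ?P b)" by (rule theI[of ?P, OF b0])
  then have "?P beta_act" unfolding beta_action_def Let_def .
  then show "is_gspace G Z q beta_act" "\<And>g y. g \<in> arrows G \<Longrightarrow> y \<in> topspace Y \<Longrightarrow> src G g = p y \<Longrightarrow> beta_act g (emb y) = emb (a g y)"
    by blast+
qed

end

section \<open>Push-forward of Radon probability measures\<close>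

lemma space_borel_sigma: "space (borel_sigma T) = topspace T"
  unfolding borel_sigma_def by (rule space_measure_of) (use openin_subset in blast)

lemma open_in_borel_sigma: "openin T U \<Longrightarrow> U \<in> sets (borel_sigma T)"
  unfolding borel_sigma_def by (subst sets_measure_of) (use openin_subset in blast, simp)

lemma continuous_map_measurable:
  assumes "continuous_map S T f"
  shows "f \<in> measurable (borel_sigma S) (borel_sigma T)"
  unfolding borel_sigma_def[of T]
proof (rule measurable_measure_of)
  show "{U. openin T U} \<subseteq> Pow (topspace T)" using openin_subset by auto
  show "f \<in> space (borel_sigma S) \<rightarrow> topspace T"
    using assms by (auto simp: space_borel_sigma continuous_map_def)
  fix U assume "U \<in> {U. openin T U}"
  then have "openin S {x \<in> topspace S. f x \<in> U}"
    using openin_continuous_map_preimage[OF assms] by simp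
  moreover have "f -` U \<inter> space (borel_sigma S) = {x \<in> topspace S. f x \<in> U}"
    by (auto simp: space_borel_sigma)
  ultimately show "f -` U \<inter> space (borel_sigma S) \<in> sets (borel_sigma S)"
    using open_in_borel_sigma by metis
qed

lemma continuous_map_borel_measurable:
  fixes f :: "'a \<Rightarrow> 'b::topological_space"
  assumes "continuous_map S euclidean f"
  shows "f \<in> borel_measurable (borel_sigma S)"
proof (rule borel_measurableI)
  fix U :: "'b set" assume "open U"
  then have "openin S {x \<in> topspace S. f x \<in> U}"
    using openin_continuous_map_preimage[OF assms] by simp
  moreover have "f -` U \<inter> space (borel_sigma S) = {x \<in> topspace S. f x \<in> U}"
    by (auto simp: space_borel_sigma)
  ultimately show "f -` U \<inter> space (borel_sigma S) \<in> sets (borel_sigma S)"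
    using open_in_borel_sigma by metis
qed

text \<open>Inner regularity transfers because the homeomorphism maps compact sets to compact sets; its
  inverse makes the images of Borel sets Borel.\<close>

lemma radon_prob_measure_distr:
  assumes \<mu>: "radon_prob_measure S \<mu>" and f: "homeomorphic_map S T f"
  shows "radon_prob_measure T (distr \<mu> (borel_sigma T) f)"
proof -
  let ?\<nu> = "distr \<mu> (borel_sigma T) f"
  interpret prob_space \<mu> using \<mu> by (simp add: radon_prob_measure_def)
  have sets: "sets \<mu> = sets (borel_sigma S)" using \<mu> by (simp add: radon_prob_measure_def)
  have sp: "space \<mu> = topspace S" using sets_eq_imp_space_eq[OF sets] space_borel_sigma by metis
  have fc: "continuous_map S T f" using f homeomorphic_imp_continuous_map by blast
  have fm: "f \<in> measurable \<mu> (borel_sigma T)"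
    using continuous_map_measurable[OF fc] measurable_cong_sets[OF sets refl] by blast
  obtain g where g: "homeomorphic_maps S T f g" using f homeomorphic_map_maps by blast
  have gm: "g \<in> measurable (borel_sigma T) \<mu>"
    using g continuous_map_measurable[of T S g] measurable_cong_sets[OF refl sets]
    by (auto simp: homeomorphic_maps_def)
  have "emeasure ?\<nu> A = (SUP K\<in>{K. compactin T K \<and> K \<subseteq> A}. emeasure ?\<nu> K)" if A: "A \<in> sets (borel_sigma T)" for A
  proof (rule antisym)
    show "(SUP K\<in>{K. compactin T K \<and> K \<subseteq> A}. emeasure ?\<nu> K) \<le> emeasure ?\<nu> A"
      using A by (auto intro!: SUP_least emeasure_mono)
    let ?B = "f -` A \<inter> space \<mu>"
    have B: "?B \<in> sets \<mu>" using measurable_sets[OF fm A] .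
    have "emeasure ?\<nu> A = emeasure \<mu> ?B" using emeasure_distr[OF fm A] .
    also have "\<dots> = (SUP K\<in>{K. compactin S K \<and> K \<subseteq> ?B}. emeasure \<mu> K)"
      using \<mu> B unfolding radon_prob_measure_def by blast
    also have "\<dots> \<le> (SUP K\<in>{K. compactin T K \<and> K \<subseteq> A}. emeasure ?\<nu> K)"
    proof (rule SUP_least)
      fix K assume "K \<in> {K. compactin S K \<and> K \<subseteq> ?B}"
      then have K: "compactin S K" "K \<subseteq> ?B" by auto
      have KS: "K \<subseteq> topspace S" using K(2) sp by blast
      have "emeasure \<mu> K \<le> emeasure ?\<nu> (f ` K)"
      proof (cases "K \<in> sets \<mu>")
        case True
        have gf: "\<And>x. x \<in> topspace S \<Longrightarrow> g (f x) = x \<and> f x \<in> topspace T" "\<And>y. y \<in> topspace T \<Longrightarrow> f (g y) = y"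
          using g fc by (auto simp: homeomorphic_maps_def continuous_map_def)
        have eq: "f ` K = g -` K \<inter> space (borel_sigma T)"
        proof (intro equalityI subsetI)
          show "y \<in> g -` K \<inter> space (borel_sigma T)" if "y \<in> f ` K" for y
            using that gf(1) KS unfolding space_borel_sigma by auto
          show "y \<in> f ` K" if "y \<in> g -` K \<inter> space (borel_sigma T)" for y
            using that gf(2)[of y] unfolding space_borel_sigma by (intro image_eqI[of _ _ "g y"]) auto
        qed
        have "f ` K \<in> sets (borel_sigma T)" unfolding eq by (rule measurable_sets[OF gm True])
        then have "emeasure ?\<nu> (f ` K) = emeasure \<mu> (f -` (f ` K) \<inter> space \<mu>)"
          and "f -` (f ` K) \<inter> space \<mu> \<in> sets \<mu>"
          using emeasure_distr[OF fm] measurable_sets[OF fm] by auto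
        moreover have "K \<subseteq> f -` (f ` K) \<inter> space \<mu>" using K(2) by auto
        ultimately show ?thesis by (metis emeasure_mono)
      qed (simp add: emeasure_notin_sets)
      also have "\<dots> \<le> (SUP K\<in>{K. compactin T K \<and> K \<subseteq> A}. emeasure ?\<nu> K)"
        using K image_compactin[OF K(1) fc] by (intro SUP_upper) auto
      finally show "emeasure \<mu> K \<le> (SUP K\<in>{K. compactin T K \<and> K \<subseteq> A}. emeasure ?\<nu> K)" .
    qed
    finally show "emeasure ?\<nu> A \<le> (SUP K\<in>{K. compactin T K \<and> K \<subseteq> A}. emeasure ?\<nu> K)" .
  qed
  then show ?thesis using prob_space_distr[OF fm] by (simp add: radon_prob_measure_def)
qed

text \<open>A measurable partition of the target pulls back to one of the source, with the same
  differences of measures; surjectivity keeps its members nonempty and distinct.\<close>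

lemma norm1_diff_distr_le:
  assumes \<mu>: "prob_space \<mu>" and \<nu>: "prob_space \<nu>" and sets: "sets \<mu> = sets \<nu>"
    and f: "f \<in> measurable \<mu> N" and onto: "f ` space \<mu> = space N"
  shows "norm1_diff (distr \<mu> N f) (distr \<nu> N f) \<le> norm1_diff \<mu> \<nu>"
proof -
  interpret \<mu>: prob_space \<mu> by fact
  interpret \<nu>: prob_space \<nu> by fact
  have sp: "space \<mu> = space \<nu>" using sets_eq_imp_space_eq[OF sets] .
  have f\<nu>: "f \<in> measurable \<nu> N" using f measurable_cong_sets[OF sets refl] by blast
  let ?Q = "\<lambda>M. {P. finite P \<and> partition_on (space M) P \<and> P \<subseteq> sets M}"
  let ?s = "\<lambda>\<mu> \<nu> P. \<Sum>A\<in>P. \<bar>measure \<mu> A - measure \<nu> A\<bar>"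
  have bdd: "bdd_above (?s \<mu> \<nu> ` ?Q \<mu>)"
  proof (rule bdd_aboveI2)
    fix P assume P: "P \<in> ?Q \<mu>"
    have disj: "disjoint_family_on (\<lambda>A. A) P" using P
      by (auto simp: partition_on_def disjoint_def disjoint_family_on_def)
    have "?s \<mu> \<nu> P \<le> (\<Sum>A\<in>P. measure \<mu> A + measure \<nu> A)"
      by (intro sum_mono) (smt (verit) measure_nonneg)
    also have "\<dots> = measure \<mu> (\<Union>A\<in>P. A) + measure \<nu> (\<Union>A\<in>P. A)"
      unfolding sum.distrib using P disj sets
        \<mu>.finite_measure_finite_Union[of P "\<lambda>A. A"] \<nu>.finite_measure_finite_Union[of P "\<lambda>A. A"] by auto
    also have "\<dots> \<le> 1 + 1" by (intro add_mono \<mu>.prob_le_1 \<nu>.prob_le_1)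
    finally show "?s \<mu> \<nu> P \<le> 2" by simp
  qed
  have "?s (distr \<mu> N f) (distr \<nu> N f) P \<le> norm1_diff \<mu> \<nu>" if P: "P \<in> ?Q (distr \<mu> N f)" for P
  proof -
    let ?v = "\<lambda>A. f -` A \<inter> space \<mu>"
    have P': "finite P" "\<Union>P = space N" "disjoint P" "{} \<notin> P" "P \<subseteq> sets N"
      using P by (auto simp: partition_on_def)
    have ne: "f ` ?v A = A" if "A \<in> P" for A
    proof -
      have "A \<subseteq> f ` space \<mu>" using that P'(2) onto by blast
      then show ?thesis by blast
    qed
    have inj: "inj_on ?v P" by (rule inj_on_inverseI[of _ "\<lambda>B. f ` B"]) (rule ne)
    have fN: "f x \<in> space N" if "x \<in> space \<mu>" for x using that onto by blast
    have "partition_on (space \<mu>) (?v ` P)"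
    proof (rule partition_onI)
      have "\<Union>(?v ` P) = f -` (\<Union>P) \<inter> space \<mu>" by auto
      then show "\<Union>(?v ` P) = space \<mu>" unfolding P'(2) using fN by auto
      show "disjnt B C" if "B \<in> ?v ` P" "C \<in> ?v ` P" "B \<noteq> C" for B C
      proof -
        obtain A A' where A: "A \<in> P" "A' \<in> P" "B = ?v A" "C = ?v A'" using \<open>B \<in> _\<close> \<open>C \<in> _\<close> by blast
        then have "A \<inter> A' = {}" using P'(3) \<open>B \<noteq> C\<close> unfolding disjoint_def by blast
        then show ?thesis using A by (auto simp: disjnt_def)
      qed
      show "{} \<notin> ?v ` P"
      proof
        assume "{} \<in> ?v ` P"
        then obtain A where A: "A \<in> P" "?v A = {}" by blast
        then have "A = {}" using ne[OF A(1)] by (metis image_empty)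
        then show False using A P'(4) by blast
      qed
    qed
    then have Q: "?v ` P \<in> ?Q \<mu>" using P' measurable_sets[OF f] by auto
    have "?s (distr \<mu> N f) (distr \<nu> N f) P = (\<Sum>A\<in>P. \<bar>measure \<mu> (?v A) - measure \<nu> (?v A)\<bar>)"
      using P'(5) measure_distr[OF f] measure_distr[OF f\<nu>] sp by (intro sum.cong) auto
    also have "\<dots> = ?s \<mu> \<nu> (?v ` P)" by (simp add: sum.reindex[OF inj])
    also have "\<dots> \<le> norm1_diff \<mu> \<nu>" unfolding norm1_diff_def by (rule cSUP_upper[OF Q bdd])
    finally show ?thesis .
  qed
  moreover have "{space N} \<in> ?Q (distr \<mu> N f)"
    using \<mu>.not_empty onto by (auto simp: partition_on_def)
  ultimately show ?thesis
    unfolding norm1_diff_def[of "distr \<mu> N f"] by (intro cSUP_least) auto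
qed

lemma compactly_supported_bounded:
  assumes "compactly_supported T f"
  obtains B where "\<And>x. x \<in> topspace T \<Longrightarrow> cmod (f x) \<le> B"
proof -
  obtain K where K: "compactin T K" "\<forall>x\<in>topspace T - K. f x = 0" and c: "continuous_map T euclidean f"
    using assms by (auto simp: compactly_supported_def)
  have "compact (f ` K)" using image_compactin[OF K(1) c] by simp
  then obtain B where "\<forall>x\<in>K. cmod (f x) \<le> B"
    using compact_imp_bounded[of "f ` K"] by (auto simp: bounded_iff)
  then show thesis using K(2) by (intro that[of "max B 0"]) (metis DiffI max.coboundedI1 max.coboundedI2 norm_zero order_refl)
qed

section \<open>The semidirect product groupoid\<close>

context gspace
begin

abbreviation H where "H \<equiv> semidirect G Y p a"

lemma gtop_H: "gtop H = subtopology (prod_topology Y (gtop G))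
    {(y, g). y \<in> topspace Y \<and> g \<in> arrows G \<and> p y = rng G g}"
  and rng_H: "rng H v = (fst v, p (fst v))"
  and src_H: "src H v = (a (ginv G (snd v)) (fst v), p (a (ginv G (snd v)) (fst v)))"
  and gmult_H: "gmult H v w = (fst v, gmult G (snd v) (snd w))"
  by (auto simp: semidirect_def case_prod_beta)

lemma arrows_H: "arrows H = {(y, g). y \<in> topspace Y \<and> g \<in> arrows G \<and> p y = rng G g}"
  unfolding arrows_def gtop_H by (auto simp: arrows_def)

lemma unit_in_arrows_H: "y \<in> topspace Y \<Longrightarrow> (y, p y) \<in> arrows H"
  using proj_unit by (auto simp: arrows_H unit_arrow rng_unit)

lemma units_H: "units H = (\<lambda>y. (y, p y)) ` topspace Y"
proof (intro equalityI subsetI)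
  fix v assume "v \<in> units H" then show "v \<in> (\<lambda>y. (y, p y)) ` topspace Y"
    by (auto simp: units_def rng_H arrows_H)
next
  fix v assume "v \<in> (\<lambda>y. (y, p y)) ` topspace Y"
  then obtain y where "y \<in> topspace Y" "v = rng H (y, p y)" by (auto simp: rng_H)
  then show "v \<in> units H" using unit_in_arrows_H by (auto simp: units_def)
qed

lemma topspace_fibre_H: "topspace (fibre_space H (y, p y)) = {y} \<times> {g \<in> arrows G. rng G g = p y} \<inter> arrows H"
  by (auto simp: fibre_space_def arrows_H rng_H arrows_def[of H, symmetric])

lemma into_H:
  assumes "continuous_map M Y c" "continuous_map M (gtop G) d" "\<And>m. m \<in> topspace M \<Longrightarrow> p (c m) = rng G (d m)"
  shows "continuous_map M (gtop H) (\<lambda>m. (c m, d m))"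
  unfolding gtop_H continuous_map_in_subtopology
  using assms continuous_map_image_subset_topspace[OF assms(1)] continuous_map_image_subset_topspace[OF assms(2)]
  by (auto simp: continuous_map_pairedI arrows_def)

lemma fst_H_cont: "continuous_map (gtop H) Y fst" and snd_H_cont: "continuous_map (gtop H) (gtop G) snd"
  unfolding gtop_H by (auto intro: continuous_map_from_subtopology continuous_map_fst continuous_map_snd)

lemma into_unit_space_H:
  assumes "continuous_map M Y c"
  shows "continuous_map M (unit_space H) (\<lambda>m. (c m, p (c m)))"
proof -
  have c: "c m \<in> topspace Y" if "m \<in> topspace M" for m using assms that by (auto simp: continuous_map_def)
  have "continuous_map M (gtop G) (\<lambda>m. p (c m))"
    using continuous_map_compose[OF assms unit_space_into_G[OF proj_cont]] by (simp add: o_def)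
  then show ?thesis
    unfolding unit_space_def continuous_map_in_subtopology units_H
    using into_H[OF assms] c proj_unit rng_unit by auto
qed

lemma into_fibre_H:
  assumes "continuous_map M (gtop H) c" "\<And>m. m \<in> topspace M \<Longrightarrow> fst (c m) = y"
  shows "continuous_map M (fibre_space H (y, p y)) c"
  unfolding fibre_space_def continuous_map_in_subtopology
  using assms continuous_map_image_subset_topspace[OF assms(1)] by (auto simp: rng_H arrows_def)

text \<open>This is where fibrewise compactness enters: compactly supported functions on \<open>G\<close> remain
  compactly supported when viewed on \<open>Y \<rtimes> G\<close>.\<close>

lemma compact_in_H:
  assumes fc: "fibrewise_compact (unit_space G) Y p" and K: "compactin (gtop G) K"
  shows "compactin (gtop H) {v \<in> arrows H. snd v \<in> K}"
proof -
  let ?P = "prod_topology Y (gtop G)"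
  let ?C = "{y \<in> topspace Y. p y \<in> rng G ` K}"
  have "compactin (unit_space G) (rng G ` K)" by (rule image_compactin[OF K rng_cont])
  then have "compactin Y ?C" using fc by (simp add: fibrewise_compact_def)
  then have CK: "compactin ?P (?C \<times> K)" using K by (simp add: compactin_Times)
  interpret X: locally_compact_Hausdorff "unit_space G" by (rule unit_space_locally_compact_Hausdorff)
  have "closedin ?P {v \<in> topspace ?P. p (fst v) = rng G (snd v)}"
  proof (rule closedin_continuous_maps_eq[OF X.Hausdorff])
    show "continuous_map ?P (unit_space G) (\<lambda>v. p (fst v))"
      using continuous_map_compose[OF continuous_map_fst proj_cont] by (simp add: o_def)
    show "continuous_map ?P (unit_space G) (\<lambda>v. rng G (snd v))"
      using continuous_map_compose[OF continuous_map_snd rng_cont] by (simp add: o_def)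
  qed
  moreover have "K \<subseteq> arrows G" using K compactin_subset_topspace arrows_def by metis
  then have "{v \<in> arrows H. snd v \<in> K} = {v \<in> topspace ?P. p (fst v) = rng G (snd v)} \<inter> (?C \<times> K)"
    by (auto simp: arrows_H arrows_def[of G])
  ultimately have "compactin ?P {v \<in> arrows H. snd v \<in> K}"
    using closed_Int_compactin[OF _ CK] by simp
  then show ?thesis unfolding gtop_H compactin_subtopology by (auto simp: arrows_H)
qed

lemma mult_H_cont:
  assumes v: "v \<in> arrows H"
  shows "continuous_map (fibre_space H (src H v)) (fibre_space H (rng H v)) (gmult H v)"
proof -
  obtain y g where v_eq: "v = (y, g)" and yg: "y \<in> topspace Y" "g \<in> arrows G" "p y = rng G g"
    using v by (auto simp: arrows_H)
  let ?y = "a (ginv G g) y"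
  let ?F = "fibre_space H (?y, p ?y)"
  have py: "p ?y = src G g" using proj_act[OF inv_arrow[OF yg(2)] yg(1)] yg by (simp add: src_inv rng_inv)
  have sub: "continuous_map ?F (gtop H) (\<lambda>v. v)" by (simp add: fibre_space_def continuous_map_from_subtopology)
  have s: "continuous_map ?F (gtop G) snd"
    using continuous_map_compose[OF sub snd_H_cont] by (simp add: o_def)
  have w: "snd w \<in> arrows G" "src G g = rng G (snd w)" if "w \<in> topspace ?F" for w
    using that py unfolding topspace_fibre_H by auto
  have "continuous_map ?F (gtop H) (\<lambda>w. (y, gmult G g (snd w)))"
  proof (rule into_H)
    show "continuous_map ?F (gtop G) (\<lambda>w. gmult G g (snd w))"
      by (rule mult_continuous[OF _ s]) (use w yg in \<open>auto simp: arrows_def\<close>)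
  qed (use yg w in \<open>auto simp: rng_mult\<close>)
  then have "continuous_map ?F (fibre_space H (y, p y)) (\<lambda>w. (y, gmult G g (snd w)))"
    by (rule into_fibre_H) simp
  moreover have "gmult H v = (\<lambda>w. (y, gmult G g (snd w)))" by (rule ext) (simp add: v_eq gmult_H)
  ultimately show ?thesis by (simp add: v_eq src_H rng_H)
qed

end

section \<open>Pulling back amenability along an equivariant map\<close>

locale equivariant_map = Z: gspace G Z q b + Y: gspace G Y p a
  for G :: "'g groupoid" and Z :: "'z topology" and q :: "'z \<Rightarrow> 'g" and b :: "'g \<Rightarrow> 'z \<Rightarrow> 'z"
    and Y :: "'y topology" and p :: "'y \<Rightarrow> 'g" and a :: "'g \<Rightarrow> 'y \<Rightarrow> 'y" +
  fixes \<phi> :: "'z \<Rightarrow> 'y"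
  assumes \<phi>_cont: "continuous_map Z Y \<phi>" and p_\<phi>: "\<And>z. z \<in> topspace Z \<Longrightarrow> p (\<phi> z) = q z"
    and \<phi>_act: "\<And>g z. g \<in> arrows G \<Longrightarrow> z \<in> topspace Z \<Longrightarrow> src G g = q z \<Longrightarrow> \<phi> (b g z) = a g (\<phi> z)"
    and Z_compact: "fibrewise_compact (unit_space G) Z q"
    and Y_compact: "fibrewise_compact (unit_space G) Y p"
begin

abbreviation HZ where "HZ \<equiv> semidirect G Z q b"
abbreviation HY where "HY \<equiv> semidirect G Y p a"

lemma \<phi>_in: "z \<in> topspace Z \<Longrightarrow> \<phi> z \<in> topspace Y"
  using \<phi>_cont by (auto simp: continuous_map_def)

text \<open>On the fibre of \<open>Y \<rtimes> G\<close> over \<open>\<phi> z\<close> this is the identification with the fibre of \<open>Z \<rtimes> G\<close> over \<open>z\<close>,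
  which leaves the arrow of \<open>G\<close> unchanged.\<close>

abbreviation (input) lift_fibre where "lift_fibre z \<equiv> \<lambda>v. (z, snd v)"

lemma lift_fibre_homeomorphic:
  assumes z: "z \<in> topspace Z"
  shows "homeomorphic_map (fibre_space HY (\<phi> z, q z)) (fibre_space HZ (z, q z)) (lift_fibre z)"
proof -
  let ?FY = "fibre_space HY (\<phi> z, q z)" and ?FZ = "fibre_space HZ (z, q z)"
  note pz = p_\<phi>[OF z]
  have tY: "topspace ?FY = {\<phi> z} \<times> {g \<in> arrows G. rng G g = q z}"
    using Y.topspace_fibre_H[of "\<phi> z"] \<phi>_in[OF z] pz by (auto simp: Y.arrows_H)
  have tZ: "topspace ?FZ = {z} \<times> {g \<in> arrows G. rng G g = q z}"
    using Z.topspace_fibre_H[of z] z by (auto simp: Z.arrows_H)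
  have "continuous_map ?FY (gtop G) snd"
    unfolding fibre_space_def by (rule continuous_map_from_subtopology[OF Y.snd_H_cont])
  then have "continuous_map ?FY (gtop HZ) (lift_fibre z)"
    by (intro Z.into_H) (use z tY in auto)
  then have 1: "continuous_map ?FY ?FZ (lift_fibre z)" by (rule Z.into_fibre_H) simp
  have "continuous_map ?FZ (gtop G) snd"
    unfolding fibre_space_def by (rule continuous_map_from_subtopology[OF Z.snd_H_cont])
  then have "continuous_map ?FZ (gtop HY) (\<lambda>v. (\<phi> z, snd v))"
    by (intro Y.into_H) (use \<phi>_in[OF z] tZ pz in auto)
  then have "continuous_map ?FZ (fibre_space HY (\<phi> z, p (\<phi> z))) (\<lambda>v. (\<phi> z, snd v))"
    by (rule Y.into_fibre_H) simp
  then have 2: "continuous_map ?FZ ?FY (\<lambda>v. (\<phi> z, snd v))" by (simp add: pz)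
  have "homeomorphic_maps ?FY ?FZ (lift_fibre z) (\<lambda>v. (\<phi> z, snd v))"
    unfolding homeomorphic_maps_def using 1 2 tY tZ by auto
  then show ?thesis by (rule homeomorphic_maps_map[THEN iffD1, THEN conjunct1])
qed

definition pull_measure :: "('y \<times> 'g \<Rightarrow> ('y \<times> 'g) measure) \<Rightarrow> 'z \<times> 'g \<Rightarrow> ('z \<times> 'g) measure" where
  "pull_measure m w = distr (m (\<phi> (fst w), snd w)) (borel_sigma (fibre_space HZ w)) (lift_fibre (fst w))"

lemma \<phi>_unit: "z \<in> topspace Z \<Longrightarrow> (\<phi> z, q z) \<in> units HY"
  using \<phi>_in p_\<phi> by (force simp: Y.units_H)

context
  fixes m :: "'y \<times> 'g \<Rightarrow> ('y \<times> 'g) measure"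
  assumes m: "continuous_prob_family HY m"
begin

lemma m_radon: "z \<in> topspace Z \<Longrightarrow> radon_prob_measure (fibre_space HY (\<phi> z, q z)) (m (\<phi> z, q z))"
  using m \<phi>_unit by (simp add: continuous_prob_family_def)

lemma m_prob: "z \<in> topspace Z \<Longrightarrow> prob_space (m (\<phi> z, q z))"
  using m_radon by (simp add: radon_prob_measure_def)

lemma sets_m: "z \<in> topspace Z \<Longrightarrow> sets (m (\<phi> z, q z)) = sets (borel_sigma (fibre_space HY (\<phi> z, q z)))"
  using m_radon by (simp add: radon_prob_measure_def)

lemma space_m: "z \<in> topspace Z \<Longrightarrow> space (m (\<phi> z, q z)) = topspace (fibre_space HY (\<phi> z, q z))"
  using sets_eq_imp_space_eq[OF sets_m] space_borel_sigma by metis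

lemma lift_fibre_measurable:
  assumes z: "z \<in> topspace Z"
  shows "lift_fibre z \<in> measurable (m (\<phi> z, q z)) (borel_sigma (fibre_space HZ (z, q z)))"
  using continuous_map_measurable[OF homeomorphic_imp_continuous_map[OF lift_fibre_homeomorphic[OF z]]]
    measurable_cong_sets[OF sets_m[OF z] refl] by blast

text \<open>Tietze's theorem extends the slice from the compact part of the fibre that meets the support \<open>L\<close>
  of a cut-off \<open>h\<close>. Since \<open>h = 1\<close> on the support of the slice, multiplication by \<open>h\<close> leaves the slice
  unchanged.\<close>

lemma slice_extends:
  assumes F: "compactly_supported (gtop HZ) F" and z0: "z0 \<in> topspace Z"
  obtains k where "compactly_supported (gtop G) k" "\<And>g. (z0, g) \<in> arrows HZ \<Longrightarrow> k g = F (z0, g)"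
proof -
  interpret G: locally_compact_Hausdorff "gtop G" by (rule Z.G_locally_compact_Hausdorff)
  obtain K where K: "compactin (gtop HZ) K" "\<And>v. v \<in> arrows HZ \<Longrightarrow> v \<notin> K \<Longrightarrow> F v = 0"
    and Fc: "continuous_map (gtop HZ) euclidean F"
    using F by (auto simp: compactly_supported_def arrows_def)
  have K1: "compactin (gtop G) (snd ` K)" by (rule image_compactin[OF K(1) Z.snd_H_cont])
  obtain h L where h: "continuous_map (gtop G) euclideanreal h" "\<And>g. g \<in> snd ` K \<Longrightarrow> h g = 1"
    "compactin (gtop G) L" "\<And>g. g \<in> topspace (gtop G) \<Longrightarrow> g \<notin> L \<Longrightarrow> h g = 0"
    using G.bump[OF K1 openin_topspace compactin_subset_topspace[OF K1]] by metis
  have qz: "q z0 \<in> topspace (unit_space G)" using Z.proj_unit[OF z0] Z.topspace_units by simp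
  interpret X: locally_compact_Hausdorff "unit_space G" by (rule Z.unit_space_locally_compact_Hausdorff)
  let ?C = "{g \<in> topspace (gtop G). rng G g \<in> {q z0}} \<inter> L"
  have C: "compactin (gtop G) ?C"
    using qz X.Hausdorff
    by (intro closed_Int_compactin closedin_continuous_map_preimage[OF Z.rng_cont] h(3)) (simp add: closedin_Hausdorff_singleton)
  have "continuous_map (subtopology (gtop G) ?C) (gtop HZ) (\<lambda>g. (z0, g))"
    by (rule Z.into_H) (use z0 in \<open>auto intro: continuous_map_from_subtopology\<close>)
  from continuous_map_compose[OF this Fc]
  have Fz: "continuous_map (subtopology (gtop G) ?C) euclidean (\<lambda>g. F (z0, g))" by (simp add: o_def)
  obtain k1 where k1: "continuous_map (gtop G) euclideanreal k1" "\<And>g. g \<in> ?C \<Longrightarrow> k1 g = Re (F (z0, g))"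
    by (rule Tietze_extension_completely_regular[OF G.completely_regular C, of UNIV "\<lambda>g. Re (F (z0, g))"])
      (use continuous_map_compose_UNIV[OF Fz continuous_on_Re[OF continuous_on_id]] in auto)
  obtain k2 where k2: "continuous_map (gtop G) euclideanreal k2" "\<And>g. g \<in> ?C \<Longrightarrow> k2 g = Im (F (z0, g))"
    by (rule Tietze_extension_completely_regular[OF G.completely_regular C, of UNIV "\<lambda>g. Im (F (z0, g))"])
      (use continuous_map_compose_UNIV[OF Fz continuous_on_Im[OF continuous_on_id]] in auto)
  define k where "k g = complex_of_real (h g) * (complex_of_real (k1 g) + \<i> * complex_of_real (k2 g))" for g
  show thesis
  proof
    have "continuous_map (gtop G) euclidean k"
      unfolding k_def
      by (intro continuous_map_mult continuous_map_add continuous_map_of_real h(1) k1(1) k2(1) continuous_map_canonical_const)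
    then show "compactly_supported (gtop G) k" using h(3,4) by (auto simp: compactly_supported_def k_def)
    fix g assume g: "(z0, g) \<in> arrows HZ"
    then have g': "g \<in> topspace (gtop G)" "rng G g = q z0" by (auto simp: Z.arrows_H arrows_def[of G])
    show "k g = F (z0, g)"
    proof (cases "g \<in> snd ` K")
      case True
      then have "g \<in> ?C" using g' h by force
      then show ?thesis using k1(2) k2(2) h(2)[OF True] by (simp add: k_def complex_eq_iff)
    next
      case False
      then have F0: "F (z0, g) = 0" using K(2)[OF g] by force
      show ?thesis
      proof (cases "g \<in> L")
        case True
        then show ?thesis using g' k1(2)[of g] k2(2)[of g] F0 by (simp add: k_def)
      qed (use h(4) g' F0 in \<open>simp add: k_def\<close>)
    qed
  qed
qed

text \<open>
  Continuity at \<open>z\<^sub>0\<close>: the slice of \<open>F\<close> at \<open>z\<^sub>0\<close> is the restriction of some \<open>k \<in> C\<^sub>c(G)\<close>. As \<open>Y\<close> is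
  fibrewise compact, \<open>(y, \<gamma>) \<mapsto> k \<gamma>\<close> has compact support on \<open>Y \<rtimes> G\<close>, so its integrals vary
  continuously. As \<open>Z\<close> is fibrewise compact, \<open>F - k\<close> has compact support on \<open>Z \<rtimes> G\<close>; it vanishes
  over \<open>z\<^sub>0\<close>, so it is uniformly small over a neighbourhood of \<open>z\<^sub>0\<close>.
\<close>

lemma integral_slice_continuous:
  assumes F: "compactly_supported (gtop HZ) F"
  shows "continuous_map Z euclidean (\<lambda>z. \<integral>v. F (z, snd v) \<partial>m (\<phi> z, q z))"
proof -
  have Fc: "continuous_map (gtop HZ) euclidean F" using F by (simp add: compactly_supported_def)
  let ?J = "\<lambda>z. \<integral>v. F (z, snd v) \<partial>m (\<phi> z, q z)"
  obtain BF where BF: "\<And>v. v \<in> arrows HZ \<Longrightarrow> cmod (F v) \<le> BF"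
    using compactly_supported_bounded[OF F] unfolding arrows_def by blast
  have near: "\<exists>N. openin Z N \<and> z0 \<in> N \<and> (\<forall>z\<in>N. dist (?J z) (?J z0) < \<epsilon>)"
    if z0: "z0 \<in> topspace Z" and \<epsilon>: "\<epsilon> > 0" for z0 \<epsilon>
  proof -
    obtain k where k: "compactly_supported (gtop G) k" "\<And>g. (z0, g) \<in> arrows HZ \<Longrightarrow> k g = F (z0, g)"
      using slice_extends[OF F z0] by blast
    have kc: "continuous_map (gtop G) euclidean k" using k(1) by (simp add: compactly_supported_def)
    obtain L where L: "compactin (gtop G) L" "\<And>g. g \<in> arrows G \<Longrightarrow> g \<notin> L \<Longrightarrow> k g = 0"
      using k(1) by (auto simp: compactly_supported_def arrows_def)
    have k_supp: "g \<in> L" if "g \<in> arrows G" "k g \<noteq> 0" for g using L(2) that by blast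
    obtain Bk where Bk: "\<And>g. g \<in> arrows G \<Longrightarrow> cmod (k g) \<le> Bk"
      using compactly_supported_bounded[OF k(1)] unfolding arrows_def by blast
    let ?I = "\<lambda>z. \<integral>v. k (snd v) \<partial>m (\<phi> z, q z)"
    have I_cont: "continuous_map Z euclidean ?I"
    proof -
      have "continuous_map (gtop HY) euclidean (\<lambda>v. k (snd v))"
        using continuous_map_compose[OF Y.snd_H_cont kc] by (simp add: o_def)
      then have "compactly_supported (gtop HY) (\<lambda>v. k (snd v))"
        using Y.compact_in_H[OF Y_compact L(1)] k_supp
        unfolding compactly_supported_def arrows_def[symmetric]
        by (intro conjI exI[of _ "{v \<in> arrows HY. snd v \<in> L}"]) (auto simp: Y.arrows_H)
      then have "continuous_map (unit_space HY) euclidean (\<lambda>x. \<integral>v. k (snd v) \<partial>m x)"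
        using m by (simp add: continuous_prob_family_def)
      from continuous_map_compose[OF Y.into_unit_space_H[OF \<phi>_cont] this]
      show ?thesis by (rule continuous_map_eq) (simp add: p_\<phi>)
    qed
    define D where "D v = F v - k (snd v)" for v
    have "continuous_map (gtop HZ) euclidean (\<lambda>v. k (snd v))"
      using continuous_map_compose[OF Z.snd_H_cont kc] by (simp add: o_def)
    then have Dc: "continuous_map (gtop HZ) euclidean D" unfolding D_def by (intro continuous_map_diff Fc)
    obtain K where K: "compactin (gtop HZ) K" "\<And>v. v \<in> arrows HZ \<Longrightarrow> v \<notin> K \<Longrightarrow> F v = 0"
      using F by (auto simp: compactly_supported_def arrows_def)
    \<comment> \<open>The projection of \<open>?Q\<close> to \<open>Z\<close> is compact and omits \<open>z0\<close>; off this projection \<open>D\<close> is small.\<close>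
    let ?Q = "{v \<in> topspace (gtop HZ). D v \<in> - ball 0 (\<epsilon>/4)} \<inter> (K \<union> {v \<in> arrows HZ. snd v \<in> L})"
    have "compactin (gtop HZ) ?Q"
      by (intro closed_Int_compactin compactin_Un K(1) Z.compact_in_H[OF Z_compact L(1)]
          closedin_continuous_map_preimage[OF Dc]) auto
    then have "compactin Z (fst ` ?Q)" using image_compactin Z.fst_H_cont by blast
    moreover have "Hausdorff_space Z" using Z.gspace by (simp add: is_gspace_def is_fibre_space_def)
    ultimately have N1: "openin Z (topspace Z - fst ` ?Q)" using compactin_imp_closedin by blast
    have z0N: "z0 \<in> topspace Z - fst ` ?Q"
    proof -
      have "D (z0, g) = 0" if "(z0, g) \<in> arrows HZ" for g using k(2)[OF that] by (simp add: D_def)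
      then show ?thesis using z0 \<epsilon> by (auto simp: arrows_def[symmetric])
    qed
    have small: "cmod (D v) \<le> \<epsilon>/4" if "v \<in> arrows HZ" "fst v \<in> topspace Z - fst ` ?Q" for v
    proof (cases "v \<in> K \<union> {v \<in> arrows HZ. snd v \<in> L}")
      case True
      then have "v \<notin> {v \<in> topspace (gtop HZ). D v \<in> - ball 0 (\<epsilon>/4)}" using that(2) by blast
      then show ?thesis using that(1) by (auto simp: arrows_def[symmetric])
    next
      case False
      then have "F v = 0" "k (snd v) = 0" using that(1) K(2) L(2) by (auto simp: Z.arrows_H)
      then show ?thesis using \<epsilon> by (simp add: D_def)
    qed
    have JI: "cmod (?J z - ?I z) \<le> \<epsilon>/4" if z: "z \<in> topspace Z - fst ` ?Q" for z
    proof -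
      have zZ: "z \<in> topspace Z" using z by blast
      let ?m = "m (\<phi> z, q z)"
      interpret prob_space ?m by (rule m_prob[OF zZ])
      have arr: "(z, snd v) \<in> arrows HZ" "snd v \<in> arrows G" if "v \<in> space ?m" for v
        using that homeomorphic_imp_continuous_map[OF lift_fibre_homeomorphic[OF zZ]] unfolding space_m[OF zZ]
        by (auto simp: continuous_map_def Z.topspace_fibre_H Z.arrows_H)
      have c1: "continuous_map (fibre_space HY (\<phi> z, q z)) (gtop HZ) (lift_fibre z)"
        using homeomorphic_imp_continuous_map[OF lift_fibre_homeomorphic[OF zZ]]
        unfolding fibre_space_def[of HZ] by (rule continuous_map_into_fulltopology)
      have m1: "(\<lambda>v. F (z, snd v)) \<in> borel_measurable ?m"
        using continuous_map_borel_measurable[OF continuous_map_compose[OF c1 Fc]]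
          measurable_cong_sets[OF sets_m[OF zZ] refl] by (auto simp: o_def)
      have c2: "continuous_map (fibre_space HY (\<phi> z, q z)) (gtop G) snd"
        unfolding fibre_space_def by (rule continuous_map_from_subtopology[OF Y.snd_H_cont])
      have m2: "(\<lambda>v. k (snd v)) \<in> borel_measurable ?m"
        using continuous_map_borel_measurable[OF continuous_map_compose[OF c2 kc]]
          measurable_cong_sets[OF sets_m[OF zZ] refl] by (auto simp: o_def)
      have i1: "integrable ?m (\<lambda>v. F (z, snd v))"
        by (rule integrable_const_bound[OF AE_I2 m1, of BF]) (use BF arr in auto)
      have i2: "integrable ?m (\<lambda>v. k (snd v))"
        by (rule integrable_const_bound[OF AE_I2 m2, of Bk]) (use Bk arr in auto)
      have "?J z - ?I z = (\<integral>v. F (z, snd v) - k (snd v) \<partial>?m)" using i1 i2 by simp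
      also have "cmod \<dots> \<le> (\<integral>v. cmod (F (z, snd v) - k (snd v)) \<partial>?m)" by (rule integral_norm_bound)
      also have "\<dots> \<le> \<epsilon>/4"
      proof (rule integral_le_const)
        show "integrable ?m (\<lambda>v. cmod (F (z, snd v) - k (snd v)))" using i1 i2 by auto
        show "AE v in ?m. cmod (F (z, snd v) - k (snd v)) \<le> \<epsilon>/4"
          using small[OF arr(1)] z by (intro AE_I2) (auto simp: D_def)
      qed
      finally show ?thesis .
    qed
    let ?N = "(topspace Z - fst ` ?Q) \<inter> {z \<in> topspace Z. ?I z \<in> ball (?I z0) (\<epsilon>/4)}"
    have "openin Z ?N" using N1 openin_continuous_map_preimage[OF I_cont, of "ball (?I z0) (\<epsilon>/4)"] by auto
    moreover have "z0 \<in> ?N" using z0N z0 \<epsilon> by auto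
    moreover have "dist (?J z) (?J z0) < \<epsilon>" if "z \<in> ?N" for z
    proof -
      have "cmod (?J z - ?I z) \<le> \<epsilon>/4" "cmod (?J z0 - ?I z0) \<le> \<epsilon>/4" "cmod (?I z0 - ?I z) < \<epsilon>/4"
        using JI[of z] JI[OF z0N] that by (auto simp: dist_norm)
      then have "cmod (?J z - ?I z) + cmod (?J z0 - ?I z0) + cmod (?I z0 - ?I z) < \<epsilon>" using \<epsilon> by linarith
      moreover have "cmod (u - u') \<le> cmod (u - v) + cmod (u' - v') + cmod (v' - v)" for u u' v v' :: complex
      proof -
        have "u - u' = ((u - v) - (u' - v')) - (v' - v)" by simp
        then have "cmod (u - u') \<le> cmod ((u - v) - (u' - v')) + cmod (v' - v)" by (metis norm_triangle_ineq4)
        then show ?thesis using norm_triangle_ineq4[of "u - v" "u' - v'"] by linarith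
      qed
      ultimately show ?thesis unfolding dist_norm by (rule le_less_trans[rotated])
    qed
    ultimately show ?thesis by blast
  qed
  show ?thesis
    unfolding continuous_map_def
  proof (intro conjI allI impI)
    fix U :: "complex set" assume "openin euclidean U"
    then have U: "open U" by simp
    show "openin Z {z \<in> topspace Z. ?J z \<in> U}"
    proof (subst openin_subopen, clarify)
      fix z assume z: "z \<in> topspace Z" "?J z \<in> U"
      then obtain \<epsilon> where \<epsilon>: "\<epsilon> > 0" "ball (?J z) \<epsilon> \<subseteq> U" using U openE by blast
      obtain N where N: "openin Z N" "z \<in> N" "\<forall>z'\<in>N. dist (?J z') (?J z) < \<epsilon>" using near[OF z(1) \<epsilon>(1)] by blast
      have "?J z' \<in> U" if "z' \<in> N" for z' using N(3) that \<epsilon>(2) by (auto simp: dist_commute subset_iff)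
      then show "\<exists>T. openin Z T \<and> z \<in> T \<and> T \<subseteq> {z \<in> topspace Z. ?J z \<in> U}"
        using N openin_subset by blast
    qed
  qed simp
qed

lemma pull_measure_continuous: "continuous_prob_family HZ (pull_measure m)"
  unfolding continuous_prob_family_def
proof (intro conjI ballI allI impI)
  fix w assume "w \<in> units HZ"
  then obtain z where z: "z \<in> topspace Z" "w = (z, q z)" by (auto simp: Z.units_H)
  show "radon_prob_measure (fibre_space HZ w) (pull_measure m w)"
    using radon_prob_measure_distr[OF m_radon lift_fibre_homeomorphic] z by (simp add: pull_measure_def)
next
  fix F assume F: "compactly_supported (gtop HZ) F"
  have fst: "continuous_map (unit_space HZ) Z fst"
    unfolding unit_space_def by (rule continuous_map_from_subtopology[OF Z.fst_H_cont])
  show "continuous_map (unit_space HZ) euclidean (\<lambda>w. integral\<^sup>L (pull_measure m w) F)"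
  proof (rule continuous_map_eq[OF continuous_map_compose[OF fst integral_slice_continuous[OF F]]])
    fix w assume "w \<in> topspace (unit_space HZ)"
    then have "w \<in> units HZ" by (auto simp: unit_space_def)
    then obtain z where z: "z \<in> topspace Z" "w = (z, q z)" by (auto simp: Z.units_H)
    have "continuous_map (fibre_space HZ (z, q z)) euclidean F"
      using F unfolding fibre_space_def compactly_supported_def by (auto intro: continuous_map_from_subtopology)
    then have Fm: "F \<in> borel_measurable (borel_sigma (fibre_space HZ (z, q z)))"
      by (rule continuous_map_borel_measurable)
    show "((\<lambda>z. \<integral>v. F (z, snd v) \<partial>m (\<phi> z, q z)) \<circ> fst) w = integral\<^sup>L (pull_measure m w) F"
      using integral_distr[OF lift_fibre_measurable[OF z(1)] Fm] z(2)
      by (simp add: pull_measure_def)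
  qed
qed

lemma \<phi>_arrow:
  assumes "(z, g) \<in> arrows HZ"
  shows "(\<phi> z, g) \<in> arrows HY" "src HY (\<phi> z, g) = (\<phi> (b (ginv G g) z), q (b (ginv G g) z))"
    "rng HY (\<phi> z, g) = (\<phi> z, q z)" "b (ginv G g) z \<in> topspace Z"
    "src HZ (z, g) = (b (ginv G g) z, q (b (ginv G g) z))" "rng HZ (z, g) = (z, q z)"
proof -
  have z: "z \<in> topspace Z" "g \<in> arrows G" "q z = rng G g" using assms by (auto simp: Z.arrows_H)
  then have i: "ginv G g \<in> arrows G" "src G (ginv G g) = q z" by (auto simp: Z.inv_arrow Z.src_inv)
  show "(\<phi> z, g) \<in> arrows HY" using z \<phi>_in p_\<phi> by (auto simp: Y.arrows_H)
  show b: "b (ginv G g) z \<in> topspace Z" using Z.act_in i z by blast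
  show "src HY (\<phi> z, g) = (\<phi> (b (ginv G g) z), q (b (ginv G g) z))"
    using \<phi>_act[OF i(1) z(1) i(2)] p_\<phi>[OF b] by (simp add: Y.src_H)
qed (use assms p_\<phi> in \<open>auto simp: Y.rng_H Z.rng_H Z.src_H Z.arrows_H\<close>)

text \<open>By equivariance the identification of the fibres commutes with translation, so both measures on
  the left are images of those on the right under one map.\<close>

lemma pull_measure_norm:
  assumes zg: "(z, g) \<in> arrows HZ"
  shows "norm1_diff (translate_measure HZ (z, g) (pull_measure m (src HZ (z, g)))) (pull_measure m (rng HZ (z, g)))
    \<le> norm1_diff (translate_measure HY (\<phi> z, g) (m (src HY (\<phi> z, g)))) (m (rng HY (\<phi> z, g)))"
proof -
  note arr = \<phi>_arrow[OF zg]
  have z: "z \<in> topspace Z" using zg by (auto simp: Z.arrows_H)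
  let ?z = "b (ginv G g) z"
  let ?BZ = "borel_sigma (fibre_space HZ (z, q z))" and ?BY = "borel_sigma (fibre_space HY (\<phi> z, q z))"
  let ?mu = "m (\<phi> ?z, q ?z)"
  interpret mu: prob_space ?mu by (rule m_prob[OF arr(4)])
  have gY: "gmult HY (\<phi> z, g) \<in> measurable ?mu ?BY"
    using continuous_map_measurable[OF Y.mult_H_cont[OF arr(1)]] measurable_cong_sets[OF sets_m[OF arr(4)] refl]
    unfolding arr(2,3) by blast
  have gZ: "gmult HZ (z, g) \<in> measurable (borel_sigma (fibre_space HZ (?z, q ?z))) ?BZ"
    using continuous_map_measurable[OF Z.mult_H_cont[OF zg]] unfolding arr(5,6) .
  have lift: "lift_fibre z \<in> measurable ?BY ?BZ"
    by (rule continuous_map_measurable[OF homeomorphic_imp_continuous_map[OF lift_fibre_homeomorphic[OF z]]])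
  have eq: "translate_measure HZ (z, g) (pull_measure m (src HZ (z, g))) = distr (distr ?mu ?BY (gmult HY (\<phi> z, g))) ?BZ (lift_fibre z)"
    using distr_distr[OF gZ lift_fibre_measurable[OF arr(4)]] distr_distr[OF lift gY]
    by (simp add: translate_measure_def arr pull_measure_def o_def Z.gmult_H Y.gmult_H)
  have "norm1_diff (distr (distr ?mu ?BY (gmult HY (\<phi> z, g))) ?BZ (lift_fibre z)) (distr (m (\<phi> z, q z)) ?BZ (lift_fibre z))
      \<le> norm1_diff (distr ?mu ?BY (gmult HY (\<phi> z, g))) (m (\<phi> z, q z))"
  proof (rule norm1_diff_distr_le)
    show "prob_space (distr ?mu ?BY (gmult HY (\<phi> z, g)))" by (rule mu.prob_space_distr[OF gY])
    show "prob_space (m (\<phi> z, q z))" by (rule m_prob[OF z])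
    show "lift_fibre z ` space (distr ?mu ?BY (gmult HY (\<phi> z, g))) = space ?BZ"
      using homeomorphic_imp_surjective_map[OF lift_fibre_homeomorphic[OF z]] by (simp add: space_borel_sigma)
  qed (use lift sets_m[OF z] in auto)
  then show ?thesis unfolding eq by (simp add: translate_measure_def arr pull_measure_def)
qed

end

text \<open>The image of a compact subset of \<open>Z \<rtimes> G\<close> in \<open>Y \<rtimes> G\<close> is compact, so uniform convergence on it
  carries over. The index set of the net stays the same.\<close>

theorem amenable_pullback:
  assumes "amenable HY"
  shows "amenable HZ"
proof -
  obtain I :: "(('y \<times> 'g) set \<times> nat) set" and le m where net: "amenability_net HY I le m"
    using assms unfolding amenable_def by blast
  have fam: "continuous_prob_family HY (m i)" if "i \<in> I" for i
    using net that by (simp add: amenability_net_def)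
  have "amenability_net HZ I le (\<lambda>i. pull_measure (m i))"
    unfolding amenability_net_def
  proof (intro conjI ballI allI impI)
    show "directed_on I le" using net by (simp add: amenability_net_def)
    show "continuous_prob_family HZ (pull_measure (m i))" if "i \<in> I" for i
      by (rule pull_measure_continuous[OF fam[OF that]])
    fix K and \<epsilon> :: real assume K: "compactin (gtop HZ) K" and \<epsilon>: "\<epsilon> > 0"
    let ?\<Phi> = "\<lambda>v. (\<phi> (fst v), snd v)"
    have KH: "K \<subseteq> arrows HZ" using compactin_subset_topspace[OF K] by (simp add: arrows_def)
    have "continuous_map (gtop HZ) (gtop HY) ?\<Phi>"
    proof (rule Y.into_H[OF _ Z.snd_H_cont])
      show "continuous_map (gtop HZ) Y (\<lambda>v. \<phi> (fst v))"
        using continuous_map_compose[OF Z.fst_H_cont \<phi>_cont] by (simp add: o_def)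
      show "p (\<phi> (fst v)) = rng G (snd v)" if "v \<in> topspace (gtop HZ)" for v
        using that p_\<phi> by (auto simp: arrows_def[symmetric] Z.arrows_H)
    qed
    then have "compactin (gtop HY) (?\<Phi> ` K)" by (rule image_compactin[OF K])
    then obtain i0 where i0: "i0 \<in> I" "\<And>i v. i \<in> I \<Longrightarrow> le i0 i \<Longrightarrow> v \<in> ?\<Phi> ` K \<Longrightarrow>
        norm1_diff (translate_measure HY v (m i (src HY v))) (m i (rng HY v)) < \<epsilon>"
      using net \<epsilon> unfolding amenability_net_def by meson
    have "norm1_diff (translate_measure HZ v (pull_measure (m i) (src HZ v))) (pull_measure (m i) (rng HZ v)) < \<epsilon>"
      if i: "i \<in> I" "le i0 i" and v: "v \<in> K" for i v
    proof -
      obtain z g where zg: "v = (z, g)" by fastforce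
      then have "(z, g) \<in> arrows HZ" "(\<phi> z, g) \<in> ?\<Phi> ` K" using v KH by force+
      then show ?thesis
        unfolding zg using pull_measure_norm[OF fam[OF i(1)], of z g] i0(2)[OF i, of "(\<phi> z, g)"] by linarith
    qed
    then show "\<exists>i0\<in>I. \<forall>i\<in>I. le i0 i \<longrightarrow> (\<forall>v\<in>K.
        norm1_diff (translate_measure HZ v (pull_measure (m i) (src HZ v))) (pull_measure (m i) (rng HZ v)) < \<epsilon>)"
      using i0(1) by blast
  qed
  then show ?thesis by (rule amenableI)
qed

end

section \<open>Strong amenability at infinity\<close>

text \<open>The orbit map \<open>\<gamma> \<mapsto> \<gamma> \<sigma>(s \<gamma>)\<close> extends to the equivariant map along which amenability is pulled
  back.\<close>

lemma amenable_beta_r_of_section: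
  fixes G :: "'g groupoid" and Y :: "'y topology"
  assumes G: "etale_groupoid G" and Y: "amenable_gspace G Y p a"
    and fc: "fibrewise_compact (unit_space G) Y p"
    and \<sigma>: "continuous_map (unit_space G) Y \<sigma>" "\<And>x. x \<in> units G \<Longrightarrow> p (\<sigma> x) = x"
  shows "amenable_gspace G (beta_r_space G) (r_beta G) (beta_r_action G)"
proof -
  interpret etale G using G by unfold_locales (auto simp: etale_groupoid_def)
  interpret B: etale_gspace G "gtop G" "rng G" "gmult G"
    by unfold_locales (rule left_mult_gspace)
  interpret Y: gspace G Y p a using Y by unfold_locales (simp add: amenable_gspace_def)
  let ?X = "unit_space G"
  have Y_lcH: "locally_compact_Hausdorff Y"
    using fc by unfold_locales (auto simp: fibrewise_compact_def is_fibre_space_def)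
  have \<sigma>_in: "\<sigma> x \<in> topspace Y" if "x \<in> units G" for x
    using \<sigma>(1) that topspace_units by (auto simp: continuous_map_def)
  have \<sigma>_src: "\<sigma> (src G g) \<in> topspace Y" "src G g = p (\<sigma> (src G g))" if "g \<in> arrows G" for g
    using that src_in_units \<sigma>_in \<sigma>(2) by auto
  have all: "{g \<in> topspace (gtop G). rng G g \<in> topspace ?X} = topspace (gtop G)"
    using rng_in_units topspace_units by (auto simp: arrows_def)
  have allZ: "B.over (topspace ?X) = topspace B.Z" using B.q_in by auto
  obtain \<phi> where \<phi>0: "continuous_map (subtopology B.Z (B.over (topspace ?X))) Y \<phi>"
    "\<And>g. g \<in> topspace (gtop G) \<Longrightarrow> rng G g \<in> topspace ?X \<Longrightarrow> \<phi> (B.emb g) = a g (\<sigma> (src G g))"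
  proof (rule B.extension[OF Y_lcH openin_topspace])
    have "continuous_map (gtop G) Y (\<lambda>g. \<sigma> (src G g))"
      using continuous_map_compose[OF src_cont \<sigma>(1)] by (simp add: o_def)
    then show "continuous_map (subtopology (gtop G) {g \<in> topspace (gtop G). rng G g \<in> topspace ?X}) Y (\<lambda>g. a g (\<sigma> (src G g)))"
      unfolding all subtopology_topspace
      by (intro Y.act_continuous) (use \<sigma>_src in \<open>auto simp: arrows_def\<close>)
    fix K assume "compactin ?X K"
    then show "\<exists>C. compactin Y C \<and> (\<forall>g\<in>topspace (gtop G). rng G g \<in> K \<longrightarrow> a g (\<sigma> (src G g)) \<in> C)"
      using fc Y.act_in[OF _ \<sigma>_src] Y.proj_act[OF _ \<sigma>_src]
      by (intro exI[of _ "{y \<in> topspace Y. p y \<in> K}"]) (auto simp: fibrewise_compact_def arrows_def[symmetric])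
  qed auto
  have \<phi>: "continuous_map B.Z Y \<phi>" using \<phi>0(1) by (simp add: allZ subtopology_topspace)
  have \<phi>_emb: "\<phi> (B.emb g) = a g (\<sigma> (src G g))" if "g \<in> arrows G" for g
    using \<phi>0(2)[of g] rng_in_units[OF that] topspace_units that by (simp add: arrows_def)
  have p_\<phi>: "p (\<phi> z) = B.q z" if z: "z \<in> topspace B.Z" for z
  proof (rule B.eq_by_density[OF openin_topspace B.Hausdorff _ _ _ z B.q_in[OF z], where g = "\<lambda>z. p (\<phi> z)"])
    show "continuous_map (subtopology B.Z (B.over (topspace ?X))) ?X (\<lambda>z. p (\<phi> z))"
      using continuous_map_compose[OF \<phi> Y.proj_cont] by (simp add: o_def allZ subtopology_topspace)
    show "continuous_map (subtopology B.Z (B.over (topspace ?X))) ?X B.q" by (rule B.q_cont_over)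
    show "p (\<phi> (B.emb g)) = B.q (B.emb g)" if "g \<in> topspace (gtop G)" for g
      using that \<phi>_emb Y.proj_act \<sigma>_src B.q_emb by (simp add: arrows_def)
  qed
  have \<phi>_act: "\<phi> (B.beta_act g z) = a g (\<phi> z)" if "g \<in> arrows G" "z \<in> topspace B.Z" "src G g = B.q z" for g z
  proof (rule B.equivariant_by_density[OF B.beta_gspace B.beta_action_emb Y.gspace \<phi> p_\<phi> _ that])
    show "\<phi> (B.emb (gmult G g h)) = a g (\<phi> (B.emb h))"
      if "g \<in> arrows G" "h \<in> topspace (gtop G)" "src G g = rng G h" for g h
      using that Y.act_act[of g h] \<sigma>_src[of h] \<phi>_emb mult_arrow src_mult by (simp add: arrows_def)
  qed auto
  interpret Z: gspace G B.Z B.q B.beta_act by unfold_locales (rule B.beta_gspace)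
  interpret equivariant_map G B.Z B.q B.beta_act Y p a \<phi>
    by unfold_locales (use \<phi> p_\<phi> \<phi>_act B.beta_fibrewise_compact fc in auto)
  have "amenable (semidirect G B.Z B.q B.beta_act)"
    using amenable_pullback Y by (simp add: amenable_gspace_def)
  then show ?thesis
    using B.beta_gspace by (simp add: amenable_gspace_def beta_r_space_def r_beta_def beta_r_action_def)
qed

theorem proposition4p9:
  fixes G :: "'g groupoid"
  assumes "etale_groupoid G"
  shows "(strongly_amenable_at_infinity TYPE(('g \<Rightarrow> complex) \<Rightarrow> complex) G \<longleftrightarrow>
            amenable_gspace G (beta_r_space G) (r_beta G) (beta_r_action G)) \<and>
         (strongly_amenable_at_infinity TYPE('y) G \<longrightarrow>
            amenable_gspace G (beta_r_space G) (r_beta G) (beta_r_action G))"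
proof (intro conjI iffI impI)
  assume am: "amenable_gspace G (beta_r_space G) (r_beta G) (beta_r_action G)"
  interpret etale G using assms by unfold_locales (auto simp: etale_groupoid_def)
  interpret B: etale_gspace G "gtop G" "rng G" "gmult G"
    by unfold_locales (rule left_mult_gspace)
  have "continuous_map (unit_space G) (gtop G) (\<lambda>x. x)"
    by (rule unit_space_into_G) simp
  from continuous_map_compose[OF this B.emb_cont]
  have "continuous_map (unit_space G) B.Z B.emb" by (simp add: o_def)
  moreover have "B.q (B.emb x) = x" if "x \<in> units G" for x
    using B.q_emb[of x] that unit_arrow rng_unit by (simp add: arrows_def)
  ultimately show "strongly_amenable_at_infinity TYPE(('g \<Rightarrow> complex) \<Rightarrow> complex) G"
    using am B.beta_fibrewise_compact
    unfolding strongly_amenable_at_infinity_def beta_r_space_def r_beta_def by blast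
qed (use amenable_beta_r_of_section[OF assms] in \<open>unfold strongly_amenable_at_infinity_def, blast+\<close>)

end
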